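(* For positive integers $k$, the numbers $shex_i(2k)$ and $stri_i(2k)$ of free saturated tree-like polyhexes and of free saturated tree-like polyiamonds of size $2k$ are given by the single expression $$shex_i(2k)=stri_i(2k)=\begin{cases}2 & \text{if } k=5,\\ 1 & \text{otherwise.}\end{cases}$$
   Context: The hexagonal (resp. triangular) lattice is the tiling of the plane by regular hexagons (resp. by equilateral triangles, edge to edge); two cells are adjacent iff they share an edge. A tree-like polyhex (resp. polyiamond) of size $n$ is a set of $n$ hexagonal (resp. triangular) cells whose induced adjacency graph is a tree. Free means considered up to isometries of the lattice (reflections included). $n(T)$ is the number of cells of $T$ and $n_1(T)$ is the number of leaves (cells of degree $1$). In each lattice, $L(n)$ is the maximum of $n_1(T)$ over all tree-like polyhexes (resp. polyiamonds) $T$ of size $n\ge2$; $T$ is fully leafed if $n_1(T)=L(n(T))$, and a fully leafed $T$ is saturated if $n_1(T)\ge \overline{L}(n(T))$, where $\overline{L}(n)=\frac{n+2}{2}$ in both lattices. *)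

theory Defs
  imports "HOL-Analysis.Analysis"
begin

section \<open>The two tilings\<close>

text \<open>
  The cells are closed regular polygons of side length 1 in the complex plane; a tiling is the set
  of its cells. With \<omega> = exp(\<i>\<pi>/3), the vertices of both tilings lie in the
  Eisenstein lattice \<int> + \<int>\<omega>.
\<close>

definition \<omega> :: complex where
  "\<omega> = cis (pi / 3)"

definition eisenstein :: "complex set" where
  "eisenstein = {of_int a + of_int b * \<omega> | a b. True}"

text \<open>
  The hexagon with centre c has vertices c + \<omega>^j. The centre of its neighbour across the
  edge from c + \<omega>^j to c + \<omega>^(j+1) is c + \<omega>^j (1 + \<omega>), so the centres
  form the lattice (1 + \<omega>)(\<int> + \<int>\<omega>).
\<close>

definition hexagon :: "complex \<Rightarrow> complex set" where
  "hexagon c = convex hull {c + \<omega> ^ j | j. j < 6}"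

definition hex_tiling :: "complex set set" where
  "hex_tiling = {hexagon ((1 + \<omega>) * z) | z. z \<in> eisenstein}"

text \<open>
  The lozenge z, z + 1, z + 1 + \<omega>, z + \<omega> is cut by its short diagonal into an upward
  and a downward equilateral triangle.
\<close>

definition tri_tiling :: "complex set set" where
  "tri_tiling = {convex hull {z, z + 1, z + \<omega>} | z. z \<in> eisenstein}
     \<union> {convex hull {z + 1, z + \<omega>, z + 1 + \<omega>} | z. z \<in> eisenstein}"

definition adjacent :: "complex set \<Rightarrow> complex set \<Rightarrow> bool" where
  "adjacent C D \<longleftrightarrow> C \<noteq> D \<and> (\<exists>e. e edge_of C \<and> e edge_of D)"

section \<open>Tree-like polyforms\<close>

definition graph_connected :: "'a set \<Rightarrow> ('a \<Rightarrow> 'a \<Rightarrow> bool) \<Rightarrow> bool" where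
  "graph_connected V E \<longleftrightarrow>
     V \<noteq> {} \<and> (\<forall>x\<in>V. \<forall>y\<in>V. (\<lambda>u v. u \<in> V \<and> v \<in> V \<and> E u v)\<^sup>*\<^sup>* x y)"

definition graph_cycle :: "'a set \<Rightarrow> ('a \<Rightarrow> 'a \<Rightarrow> bool) \<Rightarrow> 'a list \<Rightarrow> bool" where
  "graph_cycle V E xs \<longleftrightarrow> length xs \<ge> 3 \<and> distinct xs \<and> set xs \<subseteq> V \<and>
     (\<forall>i<length xs. E (xs ! i) (xs ! ((i + 1) mod length xs)))"

definition graph_tree :: "'a set \<Rightarrow> ('a \<Rightarrow> 'a \<Rightarrow> bool) \<Rightarrow> bool" where
  "graph_tree V E \<longleftrightarrow> graph_connected V E \<and> (\<nexists>xs. graph_cycle V E xs)"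

definition tree_like :: "complex set set \<Rightarrow> complex set set \<Rightarrow> bool" where
  "tree_like \<T> T \<longleftrightarrow> T \<subseteq> \<T> \<and> finite T \<and> graph_tree T adjacent"

definition cell_degree :: "complex set set \<Rightarrow> complex set \<Rightarrow> nat" where
  "cell_degree T C = card {D \<in> T. adjacent C D}"

definition num_leaves :: "complex set set \<Rightarrow> nat" where
  "num_leaves T = card {C \<in> T. cell_degree T C = 1}"

section \<open>Fully leafed and saturated polyforms\<close>

text \<open>The set below is finite and, for positive n, nonempty; only n \<ge> 2 is used.\<close>

definition max_leaves :: "complex set set \<Rightarrow> nat \<Rightarrow> nat" where
  "max_leaves \<T> n = Max {num_leaves T | T. tree_like \<T> T \<and> card T = n}"

definition leaf_bound :: "nat \<Rightarrow> real" where
  "leaf_bound n = (real n + 2) / 2"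

definition fully_leafed :: "complex set set \<Rightarrow> complex set set \<Rightarrow> bool" where
  "fully_leafed \<T> T \<longleftrightarrow>
     tree_like \<T> T \<and> card T \<ge> 2 \<and> num_leaves T = max_leaves \<T> (card T)"

definition saturated :: "complex set set \<Rightarrow> complex set set \<Rightarrow> bool" where
  "saturated \<T> T \<longleftrightarrow> fully_leafed \<T> T \<and> real (num_leaves T) \<ge> leaf_bound (card T)"

section \<open>Free polyforms\<close>

definition tiling_isometry :: "complex set set \<Rightarrow> (complex \<Rightarrow> complex) \<Rightarrow> bool" where
  "tiling_isometry \<T> f \<longleftrightarrow>
     (\<forall>x y. dist (f x) (f y) = dist x y) \<and> (\<lambda>C. f ` C) ` \<T> = \<T>"

definition congruence :: "complex set set \<Rightarrow> (complex set set \<times> complex set set) set" where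
  "congruence \<T> = {(S, T). \<exists>f. tiling_isometry \<T> f \<and> T = (\<lambda>C. f ` C) ` S}"

definition free_saturated :: "complex set set \<Rightarrow> nat \<Rightarrow> complex set set set set" where
  "free_saturated \<T> n = {T. saturated \<T> T \<and> card T = n} // congruence \<T>"

definition shex_i :: "nat \<Rightarrow> nat" where
  "shex_i n = card (free_saturated hex_tiling n)"

definition stri_i :: "nat \<Rightarrow> nat" where
  "stri_i n = card (free_saturated tri_tiling n)"

end

theory Submission
  imports Defs
begin

text \<open>
  In a tree with n vertices the degrees sum to 2 (n - 1). If no degree exceeds 3, there are therefore
  at most (n + 2) / 2 leaves, with equality exactly when every degree is 1 or 3
  (\<open>subcubic_tree_leaves\<close>). No cell of a tree-like polyform has more than three neighbours: this is
  clear for triangles, and the six neighbours of a hexagon form a ring in which at most three are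
  pairwise non-adjacent (\<open>lattice_tree_valency_le\<close>). So the saturated polyforms of size 2 k are
  exactly the induced trees on 2 k cells in which every cell has one or three neighbours; below such a
  set is called a cubic tree.

  Both tilings lead to the same problem. The centres of the hexagons form a triangular lattice in
  which adjacent cells are one step apart. The centres of the triangles form a honeycomb, which is
  a triangular lattice with one of its three colour classes removed, and again adjacent cells are one
  step apart. A polyiamond is thus a polyhex that happens to lie in the honeycomb, and it suffices to
  classify cubic trees in the triangular lattice up to lattice symmetries.

  A cubic tree has two more leaves than inner vertices, so with at least four vertices it has two
  leaves with a common neighbour v. Removing them leaves a smaller cubic tree with v as a leaf
  (\<open>cubic_tree_sprout\<close>). Conversely, the cells that can be added at a leaf v are determined
  by v and its neighbour (\<open>sprout_positions\<close>). Adding them at an end of the zigzag strip of size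
  2 k gives the strip of size 2 k + 2. Adding them at a side leaf of a strip makes a new cell touch an old
  one, unless the strip is so short that the result is either the next strip again or, from
  size 8, the tripod: a cell whose three neighbours are all inner cells. The tripod admits no
  further addition. By induction only the strips occur, and for k = 5 also the tripod
  (\<open>cubic_tree_classification\<close>), which is not congruent to a strip because every inner cell
  of a strip has a neighbouring leaf.

  The geometric part shows that sharing an edge is the same as being one lattice step apart, and that
  every lattice symmetry that preserves the set of cells is induced by an isometry of the tiling.
\<close>

section \<open>Leaves of trees\<close>

definition valency :: "'a set \<Rightarrow> ('a \<Rightarrow> 'a \<Rightarrow> bool) \<Rightarrow> 'a \<Rightarrow> nat" where
  "valency V E v = card {w \<in> V. E v w}"

lemma valency_insert:
  assumes "finite V" "w \<notin> V"
  shows "valency (insert w V) E v = valency V E v + (if E v w then 1 else 0)"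
proof -
  have "{x \<in> insert w V. E v x} = (if E v w then insert w {x \<in> V. E v x} else {x \<in> V. E v x})"
    by auto
  then show ?thesis
    using assms by (simp add: valency_def)
qed

lemma valency_one_iff: "valency V E v = 1 \<longleftrightarrow> (\<exists>u\<in>V. E v u \<and> (\<forall>x\<in>V. E v x \<longrightarrow> x = u))"
proof -
  have "valency V E v = 1 \<longleftrightarrow> (\<exists>u. {w \<in> V. E v w} = {u})"
    by (simp add: valency_def card_1_singleton_iff)
  also have "\<dots> \<longleftrightarrow> (\<exists>u\<in>V. E v u \<and> (\<forall>x\<in>V. E v x \<longrightarrow> x = u))"
    by blast
  finally show ?thesis .
qed

lemma graph_cycle_two_neighbours:
  assumes "graph_cycle V E xs" "v \<in> set xs" and sym: "\<And>x y. E x y \<Longrightarrow> E y x"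
  obtains a b where "a \<in> set xs" "b \<in> set xs" "a \<noteq> b" "E v a" "E v b"
proof -
  let ?n = "length xs"
  have n: "?n \<ge> 3" and d: "distinct xs" and E: "\<And>i. i < ?n \<Longrightarrow> E (xs ! i) (xs ! ((i + 1) mod ?n))"
    using assms(1) by (auto simp: graph_cycle_def)
  obtain i where i: "i < ?n" "v = xs ! i"
    using assms(2) by (metis in_set_conv_nth)
  define j where "j = (if i = 0 then ?n - 1 else i - 1)"
  define k where "k = (if i + 1 = ?n then 0 else i + 1)"
  have j: "j < ?n" "(j + 1) mod ?n = i" and k: "k < ?n" "(i + 1) mod ?n = k" and "j \<noteq> k"
    using i n by (auto simp: j_def k_def)
  have "E v (xs ! k)"
    using E[of i] i k by simp
  moreover have "E v (xs ! j)"
    using E[of j] j i sym by simp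
  moreover have "xs ! j \<noteq> xs ! k"
    using d j k \<open>j \<noteq> k\<close> by (simp add: nth_eq_iff_index_eq)
  ultimately show ?thesis
    using that[of "xs ! j" "xs ! k"] j k by simp
qed

text \<open>
  Being a tree is invariant under graph isomorphism; a cycle in the image is pulled back along an
  inverse of the map.
\<close>
lemma graph_tree_image:
  assumes tree: "graph_tree V E" and inj: "inj_on f V"
    and hom: "\<And>x y. x \<in> V \<Longrightarrow> y \<in> V \<Longrightarrow> E' (f x) (f y) \<longleftrightarrow> E x y"
  shows "graph_tree (f ` V) E'"
  unfolding graph_tree_def
proof
  let ?R = "\<lambda>u v. u \<in> V \<and> v \<in> V \<and> E u v"
  let ?R' = "\<lambda>u v. u \<in> f ` V \<and> v \<in> f ` V \<and> E' u v"
  have walk: "?R'\<^sup>*\<^sup>* (f x) (f y)" if "?R\<^sup>*\<^sup>* x y" for x y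
    using that
  proof induction
    case (step y z)
    then have "?R' (f y) (f z)"
      using hom by auto
    with step.IH show ?case
      by (rule rtranclp.rtrancl_into_rtrancl)
  qed simp
  show "graph_connected (f ` V) E'"
    using tree walk by (auto simp: graph_tree_def graph_connected_def)
  show "\<nexists>xs. graph_cycle (f ` V) E' xs"
  proof
    assume "\<exists>xs. graph_cycle (f ` V) E' xs"
    then obtain xs where xs: "graph_cycle (f ` V) E' xs" ..
    define g where "g = inv_into V f"
    have g: "g y \<in> V" "f (g y) = y" if "y \<in> f ` V" for y
      using that by (auto simp: g_def inv_into_into f_inv_into_f)
    have sub: "set xs \<subseteq> f ` V" and E': "\<And>i. i < length xs \<Longrightarrow> E' (xs ! i) (xs ! ((i + 1) mod length xs))"
      and "length xs \<ge> 3"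
      using xs by (auto simp: graph_cycle_def)
    have "inj_on g (set xs)"
      using g sub by (metis inj_on_def subsetD)
    moreover have "E (g (xs ! i)) (g (xs ! ((i + 1) mod length xs)))" if "i < length xs" for i
    proof -
      have "(i + 1) mod length xs < length xs"
        using \<open>length xs \<ge> 3\<close> by (intro mod_less_divisor) linarith
      then have "xs ! i \<in> f ` V" "xs ! ((i + 1) mod length xs) \<in> f ` V"
        using sub that nth_mem by blast+
      then show ?thesis
        using E'[OF that] g hom by metis
    qed
    moreover have "map g xs ! ((i + 1) mod length xs) = g (xs ! ((i + 1) mod length xs))"
      if "i < length xs" for i
      using that by (intro nth_map mod_less_divisor) linarith
    ultimately have "graph_cycle V E (map g xs)"
      using xs g(1) sub \<open>length xs \<ge> 3\<close> unfolding graph_cycle_def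
      by (simp add: distinct_map subset_iff image_iff del: add_2_eq_Suc' One_nat_def Suc_eq_plus1) blast
    then show False
      using tree by (auto simp: graph_tree_def)
  qed
qed

lemma valency_image:
  assumes "inj_on f V" "v \<in> V"
    and "\<And>x y. x \<in> V \<Longrightarrow> y \<in> V \<Longrightarrow> E' (f x) (f y) \<longleftrightarrow> E x y"
  shows "valency (f ` V) E' (f v) = valency V E v"
proof -
  have "{w \<in> f ` V. E' (f v) w} = f ` {w \<in> V. E v w}"
    using assms by auto
  moreover have "inj_on f {w \<in> V. E v w}"
    using assms(1) by (rule inj_on_subset) auto
  ultimately show ?thesis
    by (simp add: valency_def card_image)
qed

locale adjacency =
  fixes E :: "'a \<Rightarrow> 'a \<Rightarrow> bool"
  assumes sym: "E x y \<Longrightarrow> E y x"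
    and irrefl: "\<not> E x x"
begin

lemma connected_neighbour:
  assumes "graph_connected V E" "v \<in> V" "card V \<ge> 2"
  obtains w where "w \<in> V" "E v w"
proof -
  have "V \<noteq> {v}"
    using assms(3) by auto
  then obtain y where "y \<in> V" "y \<noteq> v"
    using assms(2) by blast
  then have "(\<lambda>u v. u \<in> V \<and> v \<in> V \<and> E u v)\<^sup>*\<^sup>* v y"
    using assms by (auto simp: graph_connected_def)
  then show ?thesis
    using \<open>y \<noteq> v\<close> that by (metis (no_types, lifting) converse_rtranclpE)
qed

text \<open>
  An end v of a longest path has no neighbour outside the path, since the path could be extended, and
  only its successor on the path, since any other neighbour would close a cycle.
\<close>
lemma tree_has_leaf:
  assumes "finite V" "graph_tree V E" "card V \<ge> 2"
  obtains v where "v \<in> V" "valency V E v = 1"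
proof -
  define path where "path xs \<longleftrightarrow> distinct xs \<and> set xs \<subseteq> V \<and> successively E xs" for xs
  have conn: "graph_connected V E" and acyc: "\<And>xs. \<not> graph_cycle V E xs"
    using assms(2) by (auto simp: graph_tree_def)
  have bound: "length xs \<le> card V" if "path xs" for xs
    using that assms(1) by (metis card_mono distinct_card path_def)
  have ne: "V \<noteq> {}"
    using assms(3) by auto
  have "path []"
    by (simp add: path_def)
  then obtain xs where xs: "path xs" and longest: "\<And>ys. path ys \<Longrightarrow> length ys \<le> length xs"
    using ex_has_greatest_nat[of path "[]" length "Suc (card V)"] bound by (metis le_imp_less_Suc)
  obtain a where "a \<in> V" using ne by blast
  obtain b where "b \<in> V" "E b a"
    using connected_neighbour[OF conn \<open>a \<in> V\<close> assms(3)] sym by metis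
  have "path [b, a]"
    using \<open>a \<in> V\<close> \<open>b \<in> V\<close> \<open>E b a\<close> irrefl by (auto simp: path_def)
  then have "length xs \<ge> 2"
    using longest by fastforce
  then obtain v u zs where xs_eq: "xs = v # u # zs"
    by (metis Suc_le_length_iff numeral_2_eq_2)
  have "v \<in> V" "u \<in> V" "E v u"
    using xs by (auto simp: path_def xs_eq)
  moreover have "w = u" if "w \<in> V" "E v w" for w
  proof (rule ccontr)
    assume "w \<noteq> u"
    show False
    proof (cases "w \<in> set xs")
      case False
      then have "path (w # xs)"
        using xs that sym by (auto simp: path_def xs_eq)
      then show False
        using longest by fastforce
    next
      case True
      then obtain j where j: "j < length xs" "xs ! j = w"
        by (metis in_set_conv_nth)
      have "w \<noteq> v"
        using that irrefl by auto
      have "j \<noteq> 0" "j \<noteq> 1"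
        using j(2) \<open>w \<noteq> u\<close> \<open>w \<noteq> v\<close> by (metis xs_eq nth_Cons_0, metis xs_eq nth_Cons_0 nth_Cons_Suc One_nat_def)
      then have "j \<ge> 2" by simp
      define c where "c = take (Suc j) xs"
      have len: "length c = Suc j"
        using j by (simp add: c_def)
      have "E (c ! i) (c ! ((i + 1) mod length c))" if "i < length c" for i
      proof (cases "i = j")
        case True
        then show ?thesis
          using len j sym[OF \<open>E v w\<close>] by (simp add: c_def) (simp add: xs_eq)
      next
        case False
        then have "i < j"
          using that len by simp
        then have "E (xs ! i) (xs ! Suc i)"
          using xs j by (simp add: path_def successively_conv_nth)
        then show ?thesis
          using \<open>i < j\<close> len by (simp add: c_def)
      qed
      moreover have "distinct c" "set c \<subseteq> V"
        using xs by (auto simp: c_def path_def dest: in_set_takeD)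
      ultimately have "graph_cycle V E c"
        using len \<open>j \<ge> 2\<close> by (auto simp: graph_cycle_def)
      then show False
        using acyc by blast
    qed
  qed
  ultimately have "valency V E v = 1"
    unfolding valency_one_iff by blast
  with \<open>v \<in> V\<close> show ?thesis
    by (rule that)
qed

text \<open>
  A walk that visits the leaf v can be rerouted by replacing v with its only neighbour, so the rest
  stays connected.
\<close>
lemma tree_remove_leaf:
  assumes tree: "graph_tree V E" and v: "v \<in> V" "valency V E v = 1" and "card V \<ge> 2"
  shows "graph_tree (V - {v}) E"
  unfolding graph_tree_def
proof
  obtain u where u: "u \<in> V" "E v u" and only: "\<And>x. x \<in> V \<Longrightarrow> E v x \<Longrightarrow> x = u"
    using v(2) unfolding valency_one_iff by blast
  have "u \<noteq> v" using u irrefl by auto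
  let ?R = "\<lambda>x y. x \<in> V \<and> y \<in> V \<and> E x y"
  let ?R' = "\<lambda>x y. x \<in> V - {v} \<and> y \<in> V - {v} \<and> E x y"
  define f where "f x = (if x = v then u else x)" for x
  have walk: "?R'\<^sup>*\<^sup>* (f x) (f y)" if "?R\<^sup>*\<^sup>* x y" for x y
    using that
  proof induction
    case (step y z)
    from step.hyps(2) have yz: "y \<in> V" "z \<in> V" "E y z"
      by blast+
    consider "y = v" | "z = v" | "y \<noteq> v" "z \<noteq> v" by blast
    then have "f y = f z \<or> ?R' (f y) (f z)"
    proof cases
      case 1
      then have "z = u"
        using only yz by blast
      then show ?thesis
        using 1 by (simp add: f_def)
    next
      case 2
      then have "y = u"
        using only yz sym by blast
      then show ?thesis
        using 2 by (simp add: f_def)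
    next
      case 3
      then show ?thesis
        using yz by (simp add: f_def)
    qed
    with step.IH show ?case
      by (metis (no_types, lifting) rtranclp.rtrancl_into_rtrancl)
  qed simp
  have "?R'\<^sup>*\<^sup>* x y" if "x \<in> V - {v}" "y \<in> V - {v}" for x y
  proof -
    have "?R\<^sup>*\<^sup>* x y"
      using tree that unfolding graph_tree_def graph_connected_def by blast
    then show ?thesis
      using walk[of x y] that by (simp add: f_def)
  qed
  then show "graph_connected (V - {v}) E"
    using u \<open>u \<noteq> v\<close> by (auto simp: graph_connected_def)
  show "\<nexists>xs. graph_cycle (V - {v}) E xs"
    using tree by (auto simp: graph_tree_def graph_cycle_def)
qed

text \<open>
  No cycle can pass through the new vertex, because a vertex on a cycle has two neighbours on it.
\<close>
lemma tree_insert_leaf: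
  assumes tree: "graph_tree V E" and v: "v \<notin> V" "valency V E v = 1"
  shows "graph_tree (insert v V) E"
  unfolding graph_tree_def
proof
  obtain u where u: "u \<in> V" "E v u" and only: "\<And>x. x \<in> V \<Longrightarrow> E v x \<Longrightarrow> x = u"
    using v(2) unfolding valency_one_iff by blast
  let ?R = "\<lambda>x y. x \<in> V \<and> y \<in> V \<and> E x y"
  let ?R' = "\<lambda>x y. x \<in> insert v V \<and> y \<in> insert v V \<and> E x y"
  have "?R\<^sup>*\<^sup>* \<le> ?R'\<^sup>*\<^sup>*"
    by (rule rtranclp_mono) auto
  then have old: "?R'\<^sup>*\<^sup>* x y" if "x \<in> V" "y \<in> V" for x y
    using tree that by (auto simp: graph_tree_def graph_connected_def)
  have "?R' v u" "?R' u v"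
    using u sym by auto
  then have "?R'\<^sup>*\<^sup>* x u \<and> ?R'\<^sup>*\<^sup>* u x" if "x \<in> insert v V" for x
    using old[of x u] old[of u x] u(1) that by (cases "x = v") auto
  then show "graph_connected (insert v V) E"
    unfolding graph_connected_def by (metis (no_types, lifting) insert_not_empty rtranclp_trans)
  show "\<nexists>xs. graph_cycle (insert v V) E xs"
  proof
    assume "\<exists>xs. graph_cycle (insert v V) E xs"
    then obtain xs where xs: "graph_cycle (insert v V) E xs" ..
    show False
    proof (cases "v \<in> set xs")
      case True
      obtain a b where "a \<in> set xs" "b \<in> set xs" "a \<noteq> b" "E v a" "E v b"
        using graph_cycle_two_neighbours[OF xs True sym] by blast
      then show False
        using xs only irrefl by (metis graph_cycle_def insertE subsetD)
    next
      case False
      then have "graph_cycle V E xs"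
        using xs by (auto simp: graph_cycle_def)
      then show False
        using tree by (auto simp: graph_tree_def)
    qed
  qed
qed

lemma tree_singleton: "graph_tree {v} E"
proof -
  have "\<not> graph_cycle {v} E xs" for xs
  proof
    assume "graph_cycle {v} E xs"
    then have "length xs \<ge> 3" "card (set xs) = length xs" "set xs \<subseteq> {v}"
      by (auto simp: graph_cycle_def distinct_card)
    then show False
      using card_mono[of "{v}" "set xs"] by simp
  qed
  then show ?thesis
    by (simp add: graph_tree_def graph_connected_def)
qed

lemma sum_valency_tree:
  assumes "finite V" "graph_tree V E"
  shows "(\<Sum>v\<in>V. valency V E v) + 2 = 2 * card V"
  using assms
proof (induction "card V" arbitrary: V)
  case 0
  then show ?case
    by (simp add: graph_tree_def graph_connected_def)
next
  case (Suc n V)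
  show ?case
  proof (cases "n = 0")
    case True
    then obtain v where "V = {v}"
      using Suc.hyps(2) by (metis One_nat_def card_1_singletonE)
    moreover have "{w. w = v \<and> E v w} = {}"
      using irrefl by auto
    ultimately show ?thesis
      by (simp add: valency_def)
  next
    case False
    then have "card V \<ge> 2"
      using Suc.hyps(2) by simp
    then obtain w where w: "w \<in> V" "valency V E w = 1"
      using tree_has_leaf Suc.prems by blast
    define V' where "V' = V - {w}"
    have V: "V = insert w V'" "w \<notin> V'" "finite V'"
      using w Suc.prems by (auto simp: V'_def)
    have "graph_tree V' E"
      unfolding V'_def using tree_remove_leaf Suc.prems w \<open>card V \<ge> 2\<close> by blast
    then have IH: "(\<Sum>v\<in>V'. valency V' E v) + 2 = 2 * card V'"
      using Suc.hyps V by simp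
    have "valency V' E w = 1"
      using w(2) V irrefl by (simp add: valency_insert)
    then have "card {v \<in> V'. E v w} = 1"
      unfolding valency_def
    proof -
      have "{v \<in> V'. E w v} = {v \<in> V'. E v w}"
        using sym by blast
      then show "card {v \<in> V'. E w v} = 1 \<Longrightarrow> card {v \<in> V'. E v w} = 1"
        by simp
    qed
    then have "(\<Sum>v\<in>V'. if E v w then 1 else 0) = (1::nat)"
      using V(3) by (simp add: sum.If_cases Int_def)
    moreover have "(\<Sum>v\<in>V. valency V E v) =
        valency V E w + (\<Sum>v\<in>V'. valency V' E v + (if E v w then 1 else 0))"
      using V by (simp add: valency_insert)
    ultimately show ?thesis
      using IH V w(2) by (simp add: sum.distrib)
  qed
qed

text \<open>
  The deficiencies 3 - deg(v) sum to 3 n - 2 (n - 1) = n + 2, and each leaf contributes 2 to this sum.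
\<close>
lemma subcubic_tree_leaves:
  assumes "finite V" "graph_tree V E" and deg: "\<And>v. v \<in> V \<Longrightarrow> valency V E v \<le> 3"
  shows "2 * card {v \<in> V. valency V E v = 1} \<le> card V + 2"
    and "2 * card {v \<in> V. valency V E v = 1} = card V + 2 \<longleftrightarrow>
      (\<forall>v\<in>V. valency V E v = 1 \<or> valency V E v = 3)"
proof -
  let ?L = "{v \<in> V. valency V E v = 1}"
  have "(\<Sum>v\<in>V. 3 - valency V E v) + (\<Sum>v\<in>V. valency V E v) = (\<Sum>v\<in>V. 3)"
    unfolding sum.distrib[symmetric] by (rule sum.cong) (use deg in auto)
  then have total: "(\<Sum>v\<in>V. 3 - valency V E v) = card V + 2"
    using sum_valency_tree[OF assms(1,2)] by simp
  have "(\<Sum>v\<in>V. 3 - valency V E v) = (\<Sum>v\<in>?L. 3 - valency V E v) + (\<Sum>v\<in>V - ?L. 3 - valency V E v)"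
    using assms(1) by (subst sum.subset_diff[of ?L V]) auto
  moreover have "(\<Sum>v\<in>?L. 3 - valency V E v) = 2 * card ?L"
    by simp
  ultimately have split: "card V + 2 = 2 * card ?L + (\<Sum>v\<in>V - ?L. 3 - valency V E v)"
    using total by simp
  then show "2 * card ?L \<le> card V + 2"
    by simp
  have "2 * card ?L = card V + 2 \<longleftrightarrow> (\<Sum>v\<in>V - ?L. 3 - valency V E v) = 0"
    using split by linarith
  also have "\<dots> \<longleftrightarrow> (\<forall>v\<in>V. valency V E v = 1 \<or> valency V E v = 3)"
  proof -
    have "3 - valency V E v = 0 \<longleftrightarrow> valency V E v = 3" if "v \<in> V" for v
      using deg[OF that] by linarith
    then show ?thesis
      using assms(1) by (auto simp: sum_eq_0_iff)
  qed
  finally show "2 * card ?L = card V + 2 \<longleftrightarrow> (\<forall>v\<in>V. valency V E v = 1 \<or> valency V E v = 3)" .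
qed

definition cubic_tree :: "'a set \<Rightarrow> bool" where
  "cubic_tree V \<longleftrightarrow> finite V \<and> graph_tree V E \<and> (\<forall>v\<in>V. valency V E v = 1 \<or> valency V E v = 3)"

text \<open>
  The conditions under which two new cells attached to v keep the set an induced tree: apart
  from v, they touch neither the old set nor each other.
\<close>
definition sprout :: "'a set \<Rightarrow> 'a \<Rightarrow> 'a \<Rightarrow> 'a \<Rightarrow> bool" where
  "sprout V v w1 w2 \<longleftrightarrow> v \<in> V \<and> w1 \<notin> V \<and> w2 \<notin> V \<and> w1 \<noteq> w2 \<and> E v w1 \<and> E v w2 \<and> \<not> E w1 w2 \<and>
     (\<forall>x\<in>V. E w1 x \<or> E w2 x \<longrightarrow> x = v)"

text \<open>
  There are two more leaves than inner vertices, and with at least four vertices the neighbour of a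
  leaf is an inner vertex. By the pigeonhole principle two leaves share their neighbour v. It has
  degree 3, so after their removal it is a leaf.
\<close>
lemma cubic_tree_sprout:
  assumes "cubic_tree V" "card V \<ge> 4"
  obtains V' v w1 w2 where "V = insert w1 (insert w2 V')" "cubic_tree V'" "sprout V' v w1 w2"
    "card V = card V' + 2"
proof -
  have fin: "finite V" and tree: "graph_tree V E" and deg: "\<And>v. v \<in> V \<Longrightarrow> valency V E v = 1 \<or> valency V E v = 3"
    using assms(1) by (auto simp: cubic_tree_def)
  let ?L = "{v \<in> V. valency V E v = 1}"
  \<comment> \<open>Choice of the unique neighbour of each leaf.\<close>
  define nb where "nb w = (SOME u. u \<in> V \<and> E w u)" for w
  have nb: "nb w \<in> V" "E w (nb w)" "\<And>x. x \<in> V \<Longrightarrow> E w x \<Longrightarrow> x = nb w" if w: "w \<in> ?L" for w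
  proof -
    obtain u where u: "u \<in> V" "E w u" "\<And>x. x \<in> V \<Longrightarrow> E w x \<Longrightarrow> x = u"
      using w valency_one_iff[of V E w] by auto
    have "nb w \<in> V \<and> E w (nb w)"
      unfolding nb_def using u(1,2) by (metis (mono_tags, lifting) someI)
    then show "nb w \<in> V" "E w (nb w)"
      by simp_all
    then show "x = nb w" if "x \<in> V" "E w x" for x
      using u(3)[OF that] u(3)[of "nb w"] by simp
  qed
  have inner: "nb w \<in> V - ?L" if w: "w \<in> ?L" for w
  proof (rule ccontr)
    assume "nb w \<notin> V - ?L"
    then have l: "nb w \<in> ?L"
      using nb(1)[OF w] by blast
    \<comment> \<open>Two adjacent leaves would form a component of their own.\<close>
    have returns: "nb (nb w) = w"
      using nb(3)[OF l, of w] sym[OF nb(2)[OF w]] w by simp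
    have "graph_connected (V - {w}) E" "nb w \<in> V - {w}" "card (V - {w}) \<ge> 2"
      using tree_remove_leaf[OF tree, of w] w assms(2) nb(1,2)[OF w] irrefl[of w] fin
      by (auto simp: graph_tree_def)
    then obtain x where x: "x \<in> V - {w}" "E (nb w) x"
      using connected_neighbour by blast
    then show False
      using nb(3)[OF l, of x] returns by auto
  qed
  have "2 * card ?L = card V + 2"
    using subcubic_tree_leaves(2)[OF fin tree] deg by force
  moreover have "card V = card ?L + card (V - ?L)"
    using fin card_mono[OF fin, of ?L] by (subst card_Diff_subset) auto
  ultimately have "card (V - ?L) < card ?L"
    by simp
  moreover have "card (nb ` ?L) \<le> card (V - ?L)"
    using inner fin by (intro card_mono) auto
  ultimately have "\<not> inj_on nb ?L"
    using card_image by fastforce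
  then obtain w1 w2 where w: "w1 \<in> ?L" "w2 \<in> ?L" "w1 \<noteq> w2" "nb w1 = nb w2"
    by (auto simp: inj_on_def)
  define v where "v = nb w1"
  define V' where "V' = V - {w1, w2}"
  have v: "v \<in> V" "valency V E v = 3" "E v w1" "E v w2"
    using inner[OF w(1)] deg nb(2)[OF w(1)] nb(2)[OF w(2)] w(4) sym by (auto simp: v_def)
  have only1: "x = v" if "x \<in> V" "E w1 x" for x
    using nb(3)[OF w(1) that] by (simp add: v_def)
  have only2: "x = v" if "x \<in> V" "E w2 x" for x
    using nb(3)[OF w(2) that] w(4) by (simp add: v_def)
  have V: "V = insert w1 (insert w2 V')" "w1 \<notin> insert w2 V'" "w2 \<notin> V'" "finite V'"
    using w fin by (auto simp: V'_def)
  have "v \<noteq> w1" "v \<noteq> w2"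
    using v irrefl by auto
  have nadj: "\<not> E w1 w2"
    using only1[of w2] w \<open>v \<noteq> w2\<close> by auto
  have step: "valency V E x = valency V' E x + (if x = v then 2 else 0)" if "x \<in> V'" for x
  proof -
    have "E x w1 \<longleftrightarrow> x = v" "E x w2 \<longleftrightarrow> x = v"
      using that v only1[of x] only2[of x] sym V by auto
    then show ?thesis
      using V by (simp add: valency_insert)
  qed
  have "valency (insert w2 V') E w2 = 1"
    using w(2) V nadj sym[of w2 w1] by (auto simp: valency_insert split: if_splits)
  moreover have "graph_tree (insert w2 V') E"
  proof -
    have "V - {w1} = insert w2 V'"
      using V by auto
    then show ?thesis
      using tree_remove_leaf[OF tree, of w1] w(1) assms(2) by simp
  qed
  moreover have "card (insert w2 V') \<ge> 2"
    using assms(2) V by simp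
  ultimately have "graph_tree V' E"
    using tree_remove_leaf[of "insert w2 V'" w2] V by simp
  moreover have "valency V' E x = 1 \<or> valency V' E x = 3" if "x \<in> V'" for x
  proof (cases "x = v")
    case True
    then show ?thesis
      using step[OF that] v by simp
  next
    case False
    then show ?thesis
      using step[OF that] deg[of x] that V by auto
  qed
  ultimately have "cubic_tree V'"
    using V by (simp add: cubic_tree_def)
  moreover have "sprout V' v w1 w2"
    unfolding sprout_def using v V w(3) nadj only1 only2 \<open>v \<noteq> w1\<close> \<open>v \<noteq> w2\<close> by auto
  ultimately show ?thesis
    using that V by simp
qed

lemma sprout_cubic_tree:
  assumes "cubic_tree V" "sprout V v w1 w2" "valency V E v = 1"
  shows "cubic_tree (insert w1 (insert w2 V))"
proof -
  have fin: "finite V" and tree: "graph_tree V E" and deg: "\<And>v. v \<in> V \<Longrightarrow> valency V E v = 1 \<or> valency V E v = 3"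
    using assms(1) by (auto simp: cubic_tree_def)
  have v: "v \<in> V" "w1 \<notin> V" "w2 \<notin> V" "w1 \<noteq> w2" "E v w1" "E v w2" "\<not> E w1 w2"
    and only: "\<And>x. x \<in> V \<Longrightarrow> E w1 x \<or> E w2 x \<Longrightarrow> x = v"
    using assms(2) by (auto simp: sprout_def)
  have one: "valency V E w1 = 1" "valency V E w2 = 1"
    unfolding valency_one_iff using v sym only by blast+
  have "graph_tree (insert w2 V) E"
    using tree_insert_leaf[OF tree v(3) one(2)] .
  moreover have w1: "w1 \<notin> insert w2 V" "valency (insert w2 V) E w1 = 1"
    using v one fin by (auto simp: valency_insert)
  ultimately have "graph_tree (insert w1 (insert w2 V)) E"
    by (rule tree_insert_leaf)
  moreover have "valency (insert w1 (insert w2 V)) E x \<in> {1, 3}" if x: "x \<in> insert w1 (insert w2 V)" for x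
  proof -
    consider "x = w1" | "x = w2" | "x = v" | "x \<in> V" "x \<noteq> v"
      using x by auto
    then show ?thesis
    proof cases
      case 4
      then have "\<not> E x w1" "\<not> E x w2"
        using only sym by blast+
      then show ?thesis
        using 4 deg v fin w1 by (auto simp: valency_insert)
    qed (use v w1 one fin assms(3) irrefl sym in \<open>auto simp: valency_insert\<close>)
  qed
  ultimately show ?thesis
    using fin by (auto simp: cubic_tree_def)
qed

end

section \<open>The triangular lattice and its symmetries\<close>

text \<open>
  The pair (x, y) stands for the Eisenstein integer x + y \<omega>; the six unit steps are the powers
  of \<open>\<omega>\<close>.
\<close>
definition unit_steps :: "(int \<times> int) set" where
  "unit_steps = {(1, 0), (0, 1), (-1, 1), (-1, 0), (0, -1), (1, -1)}"

definition adj :: "int \<times> int \<Rightarrow> int \<times> int \<Rightarrow> bool" where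
  "adj p q \<longleftrightarrow> q - p \<in> unit_steps"

lemma adj_pair:
  "adj (x, y) (x', y') \<longleftrightarrow>
     x' = x + 1 \<and> y' = y \<or> x' = x \<and> y' = y + 1 \<or> x' = x - 1 \<and> y' = y + 1 \<or>
     x' = x - 1 \<and> y' = y \<or> x' = x \<and> y' = y - 1 \<or> x' = x + 1 \<and> y' = y - 1"
  by (simp add: adj_def unit_steps_def diff_eq_eq eq_diff_eq add.commute minus_equation_iff)

lemma uminus_unit_steps: "d \<in> unit_steps \<Longrightarrow> - d \<in> unit_steps"
  by (auto simp: unit_steps_def)

interpretation lattice: adjacency adj
proof
  show "adj q p" if "adj p q" for p q
    using uminus_unit_steps[of "q - p"] that by (simp add: adj_def)
qed (simp add: adj_def unit_steps_def zero_prod_def)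

text \<open>Multiplication by \<open>\<omega>\<close>, that is, rotation by 60 degrees.\<close>
fun rot :: "int \<times> int \<Rightarrow> int \<times> int" where
  "rot (x, y) = (- y, x + y)"

text \<open>
  The symmetries are described by generators, so that the facts about them, including their
  realisation in the plane, follow by induction. The swap of coordinates is the reflection
  z \<mapsto> \<open>\<omega>\<close> cnj z.
\<close>
inductive lattice_symmetry :: "(int \<times> int \<Rightarrow> int \<times> int) \<Rightarrow> bool" where
  id: "lattice_symmetry (\<lambda>p. p)"
| shift: "lattice_symmetry g \<Longrightarrow> lattice_symmetry (\<lambda>p. g p + t)"
| rot: "lattice_symmetry g \<Longrightarrow> lattice_symmetry (\<lambda>p. rot (g p))"
| swap: "lattice_symmetry g \<Longrightarrow> lattice_symmetry (\<lambda>p. prod.swap (g p))"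

lemma lattice_symmetry_comp:
  assumes "lattice_symmetry g" "lattice_symmetry h"
  shows "lattice_symmetry (\<lambda>p. g (h p))"
  using assms by induction (auto intro: lattice_symmetry.intros)

lemma adj_rot: "adj (rot p) (rot q) \<longleftrightarrow> adj p q"
proof -
  have "rot q - rot p = rot (q - p)"
    by (cases p; cases q) simp
  moreover have "rot d \<in> unit_steps \<longleftrightarrow> d \<in> unit_steps" for d
    by (cases d) (auto simp: unit_steps_def)
  ultimately show ?thesis
    by (simp add: adj_def)
qed

lemma adj_swap: "adj (prod.swap p) (prod.swap q) \<longleftrightarrow> adj p q"
proof -
  have "prod.swap q - prod.swap p = prod.swap (q - p)"
    by (cases p; cases q) simp
  moreover have "prod.swap d \<in> unit_steps \<longleftrightarrow> d \<in> unit_steps" for d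
    by (cases d) (auto simp: unit_steps_def)
  ultimately show ?thesis
    by (simp add: adj_def)
qed

lemma adj_symmetry: "lattice_symmetry g \<Longrightarrow> adj (g p) (g q) \<longleftrightarrow> adj p q"
  by (induction rule: lattice_symmetry.induct) (simp_all add: adj_rot adj_swap, simp add: adj_def)

lemma bij_symmetry: "lattice_symmetry g \<Longrightarrow> bij g"
proof (induction rule: lattice_symmetry.induct)
  case id
  show ?case
    using bij_id by (simp add: id_def)
next
  case (shift g t)
  have "bij (\<lambda>p. p + t)"
    by (rule bij_plus_right)
  then show ?case
    using bij_comp[OF shift.IH] by (simp add: o_def)
next
  case (rot g)
  have "bij rot"
    by (rule o_bij[of "\<lambda>(x, y). (x + y, - x)"]) (auto simp: fun_eq_iff)
  then show ?case
    using bij_comp[OF rot.IH] by (simp add: o_def)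
next
  case (swap g)
  then show ?case
    using bij_comp[OF swap.IH bij_swap] by (simp add: o_def)
qed

lemma inj_symmetry: "lattice_symmetry g \<Longrightarrow> inj_on g V"
  using bij_symmetry bij_is_inj inj_on_subset by blast

text \<open>
  The residue of x - y modulo 3 is the proper 3-colouring of the triangular lattice; the honeycomb is
  the union of two colour classes.
\<close>
definition honeycomb :: "(int \<times> int) set" where
  "honeycomb = {(x, y). \<not> 3 dvd (x - y)}"

text \<open>
  A symmetry acts on the colours by an affine map of \<open>\<int>\<close>/3 with slope 1 or -1. The disjunction
  records the slope.
\<close>
lemma residue_symmetry:
  assumes "lattice_symmetry g"
  obtains c where "\<forall>p. 3 dvd (fst (g p) - snd (g p) - (fst p - snd p) - c)"
  | c where "\<forall>p. 3 dvd (fst (g p) - snd (g p) + (fst p - snd p) - c)"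
proof -
  have "\<exists>c. (\<forall>p. 3 dvd (fst (g p) - snd (g p) - (fst p - snd p) - c)) \<or>
     (\<forall>p. 3 dvd (fst (g p) - snd (g p) + (fst p - snd p) - c))"
    using assms
  proof induction
    case id
    show ?case
      by (intro exI[of _ 0]) simp
  next
    case (shift g t)
    then obtain c where c: "(\<forall>p. 3 dvd (fst (g p) - snd (g p) - (fst p - snd p) - c)) \<or>
       (\<forall>p. 3 dvd (fst (g p) - snd (g p) + (fst p - snd p) - c))" by blast
    have "fst (g p + t) - snd (g p + t) - d - (c + (fst t - snd t)) = fst (g p) - snd (g p) - d - c"
      "fst (g p + t) - snd (g p + t) + d - (c + (fst t - snd t)) = fst (g p) - snd (g p) + d - c" for p d
      by simp_all
    with c show ?case
      by (intro exI[of _ "c + (fst t - snd t)"]) (simp only:)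
  next
    case (rot g)
    then obtain c where c: "(\<forall>p. 3 dvd (fst (g p) - snd (g p) - (fst p - snd p) - c)) \<or>
       (\<forall>p. 3 dvd (fst (g p) - snd (g p) + (fst p - snd p) - c))" by blast
    have "3 dvd (fst (rot q) - snd (rot q) + d + c) \<longleftrightarrow> 3 dvd (fst q - snd q - d - c)"
      "3 dvd (fst (rot q) - snd (rot q) - d + c) \<longleftrightarrow> 3 dvd (fst q - snd q + d - c)" for q d
      by (cases q; simp; presburger)+
    with c show ?case
      by (intro exI[of _ "- c"]) auto
  next
    case (swap g)
    then obtain c where c: "(\<forall>p. 3 dvd (fst (g p) - snd (g p) - (fst p - snd p) - c)) \<or>
       (\<forall>p. 3 dvd (fst (g p) - snd (g p) + (fst p - snd p) - c))" by blast
    have "3 dvd (fst (prod.swap q) - snd (prod.swap q) + d + c) \<longleftrightarrow> 3 dvd (fst q - snd q - d - c)"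
      "3 dvd (fst (prod.swap q) - snd (prod.swap q) - d + c) \<longleftrightarrow> 3 dvd (fst q - snd q + d - c)" for q d
      by (cases q; simp; presburger)+
    with c show ?case
      by (intro exI[of _ "- c"]) auto
  qed
  then show ?thesis
    using that by blast
qed

text \<open>
  Adjacent points of the honeycomb have the colours 1 and 2, so a symmetry that keeps both in the
  honeycomb permutes these two colours and hence fixes the removed colour class. One edge thus decides
  whether the whole honeycomb is preserved.
\<close>
lemma symmetry_honeycomb:
  assumes g: "lattice_symmetry g" and "adj p q" "{p, q, g p, g q} \<subseteq> honeycomb"
  shows "g r \<in> honeycomb \<longleftrightarrow> r \<in> honeycomb"
proof -
  define d where "d p = fst p - snd p" for p :: "int \<times> int"
  have mem: "p \<in> honeycomb \<longleftrightarrow> \<not> 3 dvd d p" for p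
    by (simp add: honeycomb_def d_def case_prod_unfold)
  have *: "\<not> 3 dvd (d p - d q)"
    using assms(2) by (cases p; cases q) (auto simp: d_def adj_def unit_steps_def, presburger+)
  have **: "\<not> 3 dvd d p" "\<not> 3 dvd d q" "\<not> 3 dvd d (g p)" "\<not> 3 dvd d (g q)"
    using assms(3) by (simp_all add: mem)
  have "3 dvd d (g r) \<longleftrightarrow> 3 dvd d r"
  proof (rule residue_symmetry[OF g])
    fix c
    assume "\<forall>p. 3 dvd (fst (g p) - snd (g p) - (fst p - snd p) - c)"
    then have "3 dvd (d (g p) - d p - c)" "3 dvd (d (g q) - d q - c)" "3 dvd (d (g r) - d r - c)"
      unfolding d_def by blast+
    with * ** show ?thesis by presburger
  next
    fix c
    assume "\<forall>p. 3 dvd (fst (g p) - snd (g p) + (fst p - snd p) - c)"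
    then have "3 dvd (d (g p) + d p - c)" "3 dvd (d (g q) + d q - c)" "3 dvd (d (g r) + d r - c)"
      unfolding d_def by blast+
    with * ** show ?thesis by presburger
  qed
  then show ?thesis
    by (simp add: mem)
qed

lemma adj_triangle_cycle:
  assumes "a \<in> V" "b \<in> V" "c \<in> V" "adj a b" "adj b c" "adj c a"
  shows "graph_cycle V adj [a, b, c]"
proof -
  have "a \<noteq> b" "b \<noteq> c" "c \<noteq> a"
    using assms(4-6) lattice.irrefl by blast+
  moreover have "i = 0 \<or> i = 1 \<or> i = 2" if "i < length [a, b, c]" for i
    using that by auto
  ultimately show ?thesis
    using assms unfolding graph_cycle_def by fastforce
qed

text \<open>
  The six neighbours split into three pairs of adjacent points. A tree contains at most one point of each
  pair, since two of them would form a triangle with v.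
\<close>
lemma lattice_tree_valency_le:
  assumes "graph_tree V adj" "v \<in> V"
  shows "valency V adj v \<le> 3"
proof -
  let ?N = "{w \<in> V. adj v w}"
  define h :: "int \<times> int \<Rightarrow> nat" where
    "h d = (if d = (1, 0) \<or> d = (0, 1) then 0 else if d = (-1, 1) \<or> d = (-1, 0) then 1 else 2)" for d
  have h: "\<forall>d\<in>unit_steps. \<forall>d'\<in>unit_steps. h d = h d' \<longrightarrow> d \<noteq> d' \<longrightarrow> d' - d \<in> unit_steps"
    by (simp add: unit_steps_def h_def)
  have "inj_on (\<lambda>w. h (w - v)) ?N"
  proof (rule inj_onI, rule ccontr)
    fix a b
    assume ab: "a \<in> ?N" "b \<in> ?N" "h (a - v) = h (b - v)" "a \<noteq> b"
    then have "a - v \<in> unit_steps" "b - v \<in> unit_steps" "a - v \<noteq> b - v"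
      by (simp_all add: adj_def)
    then have "(b - v) - (a - v) \<in> unit_steps"
      using h ab(3) by blast
    then have "adj a b"
      by (simp add: adj_def)
    then have "graph_cycle V adj [v, a, b]"
      using ab assms(2) lattice.sym[of v b] by (intro adj_triangle_cycle) auto
    then show False
      using assms(1) by (auto simp: graph_tree_def)
  qed
  moreover have "(\<lambda>w. h (w - v)) ` ?N \<subseteq> {0, 1, 2}"
    by (auto simp: h_def)
  ultimately have "card ?N \<le> card {0, 1, 2 :: nat}"
    by (rule card_inj_on_le) simp
  then show ?thesis
    by (simp add: valency_def)
qed

section \<open>The zigzag strip and the tripod\<close>

text \<open>
  The strip grows along the diagonal: the sum x + y is the position along it, and x - y the position
  across it. The first disjunct is a path of k + 1 cells that turns alternately left and right, the
  second consists of one side leaf at each of its k - 1 inner cells. As x + y and x - y have the same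
  parity, there is at most one path cell and at most one side leaf for each value of x + y.
\<close>
definition zigzag :: "nat \<Rightarrow> (int \<times> int) set" where
  "zigzag k = {(x, y). x - y \<in> {1, 2} \<and> 1 \<le> x + y \<and> x + y \<le> int k + 1 \<or>
     x - y \<in> {-1, 4} \<and> 2 \<le> x + y \<and> x + y \<le> int k}"

text \<open>
  The strip of size 8 with two cells added at the side leaf (1, 2). The inner cells are (2, 1) and its
  three neighbours.
\<close>
definition tripod :: "(int \<times> int) set" where
  "tripod = insert (0, 2) (insert (1, 3) (zigzag 4))"

lemma zigzag_mem: "(x, y) \<in> zigzag k \<longleftrightarrow>
    (x = y + 1 \<or> x = y + 2) \<and> 1 \<le> x + y \<and> x + y \<le> int k + 1 \<or>
    (x = y - 1 \<or> x = y + 4) \<and> 2 \<le> x + y \<and> x + y \<le> int k"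
  by (auto simp: zigzag_def)

lemma zigzag_subset_honeycomb: "zigzag k \<subseteq> honeycomb"
  by (auto simp: zigzag_def honeycomb_def)

lemma zigzag_1: "zigzag 1 = {(1, 0), (2, 0)}"
proof (rule set_eqI)
  fix p :: "int \<times> int"
  obtain x y where p: "p = (x, y)"
    by (cases p)
  have "p \<in> zigzag 1 \<longleftrightarrow> x = y + 1 \<and> y = 0 \<or> x = y + 2 \<and> y = 0"
    unfolding p zigzag_mem by presburger
  then show "p \<in> zigzag 1 \<longleftrightarrow> p \<in> {(1, 0), (2, 0)}"
    by (auto simp: p)
qed

lemma zigzag_4: "zigzag 4 = {(1, 0), (2, 0), (2, 1), (3, 1), (3, 2), (3, -1), (1, 2), (4, 0)}"
proof
  show "zigzag 4 \<subseteq> {(1, 0), (2, 0), (2, 1), (3, 1), (3, 2), (3, -1), (1, 2), (4, 0)}"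
  proof
    fix p :: "int \<times> int"
    assume "p \<in> zigzag 4"
    moreover obtain x y where p: "p = (x, y)"
      by (cases p)
    ultimately consider "x = y + 1" "0 \<le> y" "y \<le> 2" | "x = y + 2" "0 \<le> y" "y \<le> 1"
      | "x = y - 1" "y = 2" | "x = y + 4" "-1 \<le> y" "y \<le> 0"
      by (auto simp: zigzag_mem)
    then show "p \<in> {(1, 0), (2, 0), (2, 1), (3, 1), (3, 2), (3, -1), (1, 2), (4, 0)}"
    proof cases
      case 1
      then have "y = 0 \<or> y = 1 \<or> y = 2" by linarith
      with 1 show ?thesis by (auto simp: p)
    next
      case 2
      then have "y = 0 \<or> y = 1" by linarith
      with 2 show ?thesis by (auto simp: p)
    next
      case 4
      then have "y = 0 \<or> y = -1" by linarith
      with 4 show ?thesis by (auto simp: p)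
    qed (simp add: p)
  qed
qed (simp add: zigzag_mem)

lemma tripod_subset_honeycomb: "tripod \<subseteq> honeycomb"
  by (auto simp: tripod_def zigzag_4 honeycomb_def)

lemma all_adj_iff: "(\<forall>p\<in>V. adj (x, y) p \<longrightarrow> P p) \<longleftrightarrow>
    ((x + 1, y) \<in> V \<longrightarrow> P (x + 1, y)) \<and> ((x, y + 1) \<in> V \<longrightarrow> P (x, y + 1)) \<and>
    ((x - 1, y + 1) \<in> V \<longrightarrow> P (x - 1, y + 1)) \<and> ((x - 1, y) \<in> V \<longrightarrow> P (x - 1, y)) \<and>
    ((x, y - 1) \<in> V \<longrightarrow> P (x, y - 1)) \<and> ((x + 1, y - 1) \<in> V \<longrightarrow> P (x + 1, y - 1))"
proof -
  have "(\<forall>p\<in>V. adj (x, y) p \<longrightarrow> P p) \<longleftrightarrow> (\<forall>p. adj (x, y) p \<longrightarrow> p \<in> V \<longrightarrow> P p)"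
    by blast
  also have "\<dots> \<longleftrightarrow> (\<forall>p\<in>{(x + 1, y), (x, y + 1), (x - 1, y + 1), (x - 1, y), (x, y - 1), (x + 1, y - 1)}.
      p \<in> V \<longrightarrow> P p)"
  proof -
    have "adj (x, y) p \<longleftrightarrow>
        p \<in> {(x + 1, y), (x, y + 1), (x - 1, y + 1), (x - 1, y), (x, y - 1), (x + 1, y - 1)}" for p
      by (cases p) (simp add: adj_pair)
    then show ?thesis by blast
  qed
  finally show ?thesis
    by simp
qed

lemma sproutI:
  assumes "v \<in> V" "w1 \<notin> V" "w2 \<notin> V" "w1 \<noteq> w2" "adj v w1" "adj v w2" "\<not> adj w1 w2"
    and "\<forall>p\<in>V. adj w1 p \<longrightarrow> p = v" "\<forall>p\<in>V. adj w2 p \<longrightarrow> p = v"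
  shows "lattice.sprout V v w1 w2"
  using assms unfolding lattice.sprout_def by blast

lemma lattice_leafI:
  assumes "u \<in> V" "adj v u" "\<forall>p\<in>V. adj v p \<longrightarrow> p = u"
  shows "valency V adj v = 1"
  using assms unfolding valency_one_iff by blast

lemma zigzag_Suc_even:
  fixes m :: int
  assumes "int k = 2 * m" "k \<ge> 1"
  shows "zigzag (Suc k) = insert (m + 2, m) (insert (m, m + 1) (zigzag k))"
proof (rule set_eqI)
  fix p :: "int \<times> int"
  obtain x y where p: "p = (x, y)"
    by (cases p)
  consider "x = y + 1" | "x = y + 2" | "x = y - 1" | "x = y + 4" | "x - y \<notin> {1, 2, -1, 4}"
    by force
  then show "p \<in> zigzag (Suc k) \<longleftrightarrow> p \<in> insert (m + 2, m) (insert (m, m + 1) (zigzag k))"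
    using assms by cases (auto simp: p zigzag_mem, presburger+)
qed

lemma zigzag_Suc_odd:
  fixes m :: int
  assumes "int k = 2 * m + 1" "k \<ge> 1"
  shows "zigzag (Suc k) = insert (m + 2, m + 1) (insert (m + 3, m - 1) (zigzag k))"
proof (rule set_eqI)
  fix p :: "int \<times> int"
  obtain x y where p: "p = (x, y)"
    by (cases p)
  consider "x = y + 1" | "x = y + 2" | "x = y - 1" | "x = y + 4" | "x - y \<notin> {1, 2, -1, 4}"
    by force
  then show "p \<in> zigzag (Suc k) \<longleftrightarrow> p \<in> insert (m + 2, m + 1) (insert (m + 3, m - 1) (zigzag k))"
    using assms by cases (auto simp: p zigzag_mem, presburger+)
qed

text \<open>
  The strip is extended at the end of its path, where v is the last path cell. The direction of the
  extension depends on the parity of k.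
\<close>
lemma zigzag_Suc:
  assumes "k \<ge> 1"
  obtains v w1 w2 where "zigzag (Suc k) = insert w1 (insert w2 (zigzag k))"
    "lattice.sprout (zigzag k) v w1 w2" "valency (zigzag k) adj v = 1"
proof (cases "even k")
  case True
  then obtain m where m: "int k = 2 * m" "m \<ge> 1"
    using assms by (auto elim!: evenE)
  have "zigzag (Suc k) = insert (m + 2, m) (insert (m, m + 1) (zigzag k))"
    by (rule zigzag_Suc_even[OF m(1) assms])
  moreover have "lattice.sprout (zigzag k) (m + 1, m) (m + 2, m) (m, m + 1)"
    using m(2) by (intro sproutI) (simp_all add: all_adj_iff zigzag_mem m(1) adj_pair)
  moreover have "valency (zigzag k) adj (m + 1, m) = 1"
    using m(2) by (intro lattice_leafI[of "(m + 1, m - 1)"]) (simp_all add: all_adj_iff zigzag_mem m(1) adj_pair)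
  ultimately show ?thesis
    by (rule that)
next
  case False
  then obtain n where "k = 2 * n + 1"
    by (auto elim!: oddE)
  then obtain m where m: "int k = 2 * m + 1" "m \<ge> 0"
    by (metis of_nat_0_le_iff of_nat_1 of_nat_add of_nat_mult of_nat_numeral)
  have "zigzag (Suc k) = insert (m + 2, m + 1) (insert (m + 3, m - 1) (zigzag k))"
    by (rule zigzag_Suc_odd[OF m(1) assms])
  moreover have "lattice.sprout (zigzag k) (m + 2, m) (m + 2, m + 1) (m + 3, m - 1)"
    using m(2) by (intro sproutI) (simp_all add: all_adj_iff zigzag_mem m(1) adj_pair)
  moreover have "valency (zigzag k) adj (m + 2, m) = 1"
    using m(2) by (intro lattice_leafI[of "(m + 1, m)"]) (simp_all add: all_adj_iff zigzag_mem m(1) adj_pair)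
  ultimately show ?thesis
    by (rule that)
qed

lemma zigzag_cubic_tree:
  assumes "k \<ge> 1"
  shows "lattice.cubic_tree (zigzag k) \<and> card (zigzag k) = 2 * k"
  using assms
proof (induction k rule: nat_induct_at_least)
  case base
  have one: "valency {(2, 0)} adj (1, 0) = 1" "valency {(1, 0), (2, 0)} adj (1, 0) = 1"
    by (rule lattice_leafI[of "(2, 0)"]; simp add: all_adj_iff adj_pair)+
  have two: "valency {(1, 0), (2, 0)} adj (2, 0) = 1"
    by (rule lattice_leafI[of "(1, 0)"]; simp add: all_adj_iff adj_pair)
  have "graph_tree {(1, 0), (2, 0)} adj"
    by (rule lattice.tree_insert_leaf[OF lattice.tree_singleton]) (simp_all only: one, simp)
  then show ?case
    unfolding zigzag_1 by (simp add: lattice.cubic_tree_def one two)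
next
  case (Suc k)
  obtain v w1 w2 where z: "zigzag (Suc k) = insert w1 (insert w2 (zigzag k))"
    and sprout: "lattice.sprout (zigzag k) v w1 w2" and leaf: "valency (zigzag k) adj v = 1"
    by (rule zigzag_Suc[OF Suc.hyps(1)])
  have "lattice.cubic_tree (zigzag (Suc k))"
    unfolding z by (rule lattice.sprout_cubic_tree[OF _ sprout leaf]) (use Suc.IH in blast)
  moreover have "w1 \<notin> insert w2 (zigzag k)" "w2 \<notin> zigzag k"
    using sprout unfolding lattice.sprout_def by blast+
  moreover have "finite (zigzag k)"
    using Suc.IH unfolding lattice.cubic_tree_def by blast
  ultimately have "lattice.cubic_tree (zigzag (Suc k))" "card (zigzag (Suc k)) = 2 * Suc k"
    using Suc.IH by (simp_all only: z card_insert_disjoint finite_insert, simp)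
  then show ?case ..
qed

lemma tripod_cubic_tree: "lattice.cubic_tree tripod" "card tripod = 10"
proof -
  have "lattice.sprout (zigzag 4) (1, 2) (0, 2) (1, 3)"
    by (intro sproutI) (simp_all add: all_adj_iff zigzag_4 adj_pair)
  moreover have "valency (zigzag 4) adj (1, 2) = 1"
    by (intro lattice_leafI[of "(2, 1)"]) (simp_all add: all_adj_iff zigzag_4 adj_pair)
  ultimately show "lattice.cubic_tree tripod"
    unfolding tripod_def using lattice.sprout_cubic_tree zigzag_cubic_tree[of 4] by simp
  show "card tripod = 10"
    by (simp add: tripod_def zigzag_4)
qed

text \<open>
  An invariant that distinguishes the tripod from the strip of the same size: an inner
  vertex without a leaf as neighbour.
\<close>
definition has_hub :: "'a set \<Rightarrow> ('a \<Rightarrow> 'a \<Rightarrow> bool) \<Rightarrow> bool" where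
  "has_hub V E \<longleftrightarrow> (\<exists>c\<in>V. valency V E c \<noteq> 1 \<and> (\<forall>d\<in>V. E c d \<longrightarrow> valency V E d \<noteq> 1))"

lemma tripod_has_hub: "has_hub tripod adj"
proof -
  have two: "valency tripod adj v \<noteq> 1" if "u \<in> tripod" "w \<in> tripod" "u \<noteq> w" "adj v u" "adj v w" for u v w
    using that unfolding valency_one_iff by blast
  have "valency tripod adj (2, 1) \<noteq> 1"
    by (rule two[of "(2, 0)" "(3, 1)"]) (simp_all add: tripod_def zigzag_4 adj_pair)
  moreover have "valency tripod adj (2, 0) \<noteq> 1"
    by (rule two[of "(1, 0)" "(2, 1)"]) (simp_all add: tripod_def zigzag_4 adj_pair)
  moreover have "valency tripod adj (3, 1) \<noteq> 1"
    by (rule two[of "(3, 2)" "(2, 1)"]) (simp_all add: tripod_def zigzag_4 adj_pair)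
  moreover have "valency tripod adj (1, 2) \<noteq> 1"
    by (rule two[of "(0, 2)" "(2, 1)"]) (simp_all add: tripod_def zigzag_4 adj_pair)
  moreover have "(2, 1) \<in> tripod"
    by (simp add: tripod_def zigzag_4)
  ultimately show ?thesis
    unfolding has_hub_def
    by (intro bexI[of _ "(2, 1)"] conjI) (simp_all add: all_adj_iff tripod_def zigzag_4)
qed

lemma zigzag_leaf:
  assumes "k \<ge> 1" "(x, y) \<in> zigzag k"
    and "x + y = 1 \<or> x + y = int k + 1 \<or> x - y = -1 \<or> x - y = 4"
  shows "valency (zigzag k) adj (x, y) = 1"
proof -
  consider "x + y = 1" | "x - y = 1" "x + y = int k + 1" | "x - y = 2" "x + y = int k + 1"
    | "x - y = -1" | "x - y = 4"
    using assms by (auto simp: zigzag_mem)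
  then show ?thesis
  proof cases
    case 1
    then have "x = 1" "y = 0"
      using assms(2) by (auto simp: zigzag_mem)
    with assms(1) show ?thesis
      by (intro lattice_leafI[of "(2, 0)"]) (simp_all add: all_adj_iff zigzag_mem adj_pair)
  next
    case 2
    then show ?thesis
      using assms(1) 
      by (intro lattice_leafI[of "(x, y - 1)"]) (auto simp: all_adj_iff zigzag_mem adj_pair)
  next
    case 3
    then show ?thesis
      using assms(1) 
      by (intro lattice_leafI[of "(x - 1, y)"]) (auto simp: all_adj_iff zigzag_mem adj_pair)
  next
    case 4
    then show ?thesis
      using assms(2) 
      by (intro lattice_leafI[of "(x + 1, y - 1)"]) (auto simp: all_adj_iff zigzag_mem adj_pair)
  next
    case 5
    then show ?thesis
      using assms(2) 
      by (intro lattice_leafI[of "(x - 1, y + 1)"]) (auto simp: all_adj_iff zigzag_mem adj_pair)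
  qed
qed

lemma zigzag_no_hub:
  assumes "k \<ge> 1"
  shows "\<not> has_hub (zigzag k) adj"
proof -
  have "valency (zigzag k) adj (x, y) = 1 \<or> (\<exists>d\<in>zigzag k. adj (x, y) d \<and> valency (zigzag k) adj d = 1)"
    if xy: "(x, y) \<in> zigzag k" for x y
  proof (cases "x + y = 1 \<or> x + y = int k + 1 \<or> x - y = -1 \<or> x - y = 4")
    case True
    then show ?thesis
      using zigzag_leaf[OF assms xy] by blast
  next
    case False
    then consider "x = y + 1" | "x = y + 2"
      using xy by (auto simp: zigzag_mem)
    then have "\<exists>a b. (a, b) \<in> zigzag k \<and> adj (x, y) (a, b) \<and> (a - b = -1 \<or> a - b = 4)"
    proof cases
      case 1
      then show ?thesis
        using False xy by (intro exI[of _ "x - 1"] exI[of _ "y + 1"]) (auto simp: zigzag_mem adj_pair)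
    next
      case 2
      then show ?thesis
        using False xy by (intro exI[of _ "x + 1"] exI[of _ "y - 1"]) (auto simp: zigzag_mem adj_pair)
    qed
    then show ?thesis
      using zigzag_leaf[OF assms] by blast
  qed
  then show ?thesis
    unfolding has_hub_def by fastforce
qed

section \<open>Classification of the cubic trees\<close>

text \<open>
  The old neighbour u and the two new ones are three pairwise non-adjacent neighbours of v, hence they lie
  in alternate directions. So the new cells are v + \<open>\<omega>\<^sup>2\<close> (u - v) and v + \<open>\<omega>\<^sup>4\<close> (u - v), where
  \<open>\<omega>\<^sup>4 = - \<omega>\<close>.
\<close>
lemma sprout_positions:
  assumes s: "lattice.sprout V v w1 w2" and u: "u \<in> V" "adj v u"
  shows "{w1, w2} = {v + rot (rot (u - v)), v - rot (u - v)}"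
proof -
  \<comment> \<open>A finite check over all triples of unit steps.\<close>
  have steps: "\<forall>d\<in>unit_steps. \<forall>e\<in>unit_steps. \<forall>f\<in>unit_steps.
      d \<noteq> e \<and> d \<noteq> f \<and> e \<noteq> f \<and> d - e \<notin> unit_steps \<and> d - f \<notin> unit_steps \<and> f - e \<notin> unit_steps \<longrightarrow>
      e = rot (rot d) \<and> f = - rot d \<or> e = - rot d \<and> f = rot (rot d)"
    by (simp add: unit_steps_def)
  have w: "w1 \<notin> V" "w2 \<notin> V" "w1 \<noteq> w2" "adj v w1" "adj v w2" "\<not> adj w1 w2"
    using s unfolding lattice.sprout_def by blast+
  have "\<not> adj w1 u" "\<not> adj w2 u"
    using s u lattice.irrefl unfolding lattice.sprout_def by metis+
  then have "w1 - v = rot (rot (u - v)) \<and> w2 - v = - rot (u - v) \<or>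
      w1 - v = - rot (u - v) \<and> w2 - v = rot (rot (u - v))"
    using w u by (intro steps[rule_format]) (auto simp: adj_def)
  then show ?thesis
    by (elim disjE conjE) (simp_all add: diff_eq_eq add.commute insert_commute)
qed

lemma sprout_image:
  assumes s: "lattice.sprout V v w1 w2" and g: "lattice_symmetry g"
  shows "lattice.sprout (g ` V) (g v) (g w1) (g w2)"
proof -
  have inj: "g p = g q \<longleftrightarrow> p = q" "g p \<in> g ` V \<longleftrightarrow> p \<in> V" for p q
    using inj_symmetry[OF g, of UNIV] by (simp_all add: inj_eq inj_image_mem_iff)
  show ?thesis
    using s unfolding lattice.sprout_def by (simp add: inj adj_symmetry[OF g])
qed

definition equivalent :: "(int \<times> int) set \<Rightarrow> (int \<times> int) set \<Rightarrow> bool" where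
  "equivalent V W \<longleftrightarrow> (\<exists>g. lattice_symmetry g \<and> g ` V = W)"

lemma equivalentI: "lattice_symmetry g \<Longrightarrow> g ` V = W \<Longrightarrow> equivalent V W"
  by (auto simp: equivalent_def)

lemma equivalent_trans:
  assumes "equivalent U V" "equivalent V W"
  shows "equivalent U W"
proof -
  obtain g h where "lattice_symmetry g" "g ` U = V" "lattice_symmetry h" "h ` V = W"
    using assms unfolding equivalent_def by blast
  moreover from this have "(\<lambda>p. h (g p)) ` U = W"
    by (metis image_image)
  ultimately show ?thesis
    using equivalentI[OF lattice_symmetry_comp] by blast
qed

lemma equivalent_refl: "equivalent V V"
  by (rule equivalentI[OF lattice_symmetry.id]) simp

text \<open>
  The glide reflection along the axis of the strip that moves each path cell to the next one; the
  reflection in the line through the path cells (2, 0) and (2, 1), which maps the strip of size 6 to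
  itself; the rotation by 120 degrees about (2, 0), which maps the strip of size 4 to itself.
\<close>
lemma symmetry_glide: "lattice_symmetry (\<lambda>p. prod.swap p + (2, -1))"
  by (intro lattice_symmetry.intros)

lemma symmetry_reflection: "lattice_symmetry (\<lambda>p. rot (prod.swap p) + (4, -2))"
  by (intro lattice_symmetry.intros)

lemma symmetry_rotation: "lattice_symmetry (\<lambda>p. rot (rot p) + (4, -2))"
  by (intro lattice_symmetry.intros)

lemma zigzag_2: "zigzag 2 = {(1, 0), (2, 0), (2, 1), (3, -1)}"
proof
  show "zigzag 2 \<subseteq> {(1, 0), (2, 0), (2, 1), (3, -1)}"
  proof
    fix p :: "int \<times> int"
    assume "p \<in> zigzag 2"
    moreover obtain x y where p: "p = (x, y)"
      by (cases p)
    ultimately consider "x = y + 1" "0 \<le> y" "y \<le> 1" | "x = y + 2" "y = 0" | "x = y + 4" "y = -1"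
      by (auto simp: zigzag_mem)
    then show "p \<in> {(1, 0), (2, 0), (2, 1), (3, -1)}"
    proof cases
      case 1
      then have "y = 0 \<or> y = 1" by linarith
      with 1 show ?thesis by (auto simp: p)
    qed (simp_all add: p)
  qed
qed (simp add: zigzag_mem)

lemma zigzag_3: "zigzag 3 = {(1, 0), (2, 0), (2, 1), (3, 1), (3, -1), (1, 2)}"
proof
  show "zigzag 3 \<subseteq> {(1, 0), (2, 0), (2, 1), (3, 1), (3, -1), (1, 2)}"
  proof
    fix p :: "int \<times> int"
    assume "p \<in> zigzag 3"
    moreover obtain x y where p: "p = (x, y)"
      by (cases p)
    ultimately consider "x = y + 1" "0 \<le> y" "y \<le> 1" | "x = y + 2" "0 \<le> y" "y \<le> 1"
      | "x = y - 1" "y = 2" | "x = y + 4" "y = -1"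
      by (auto simp: zigzag_mem)
    then show "p \<in> {(1, 0), (2, 0), (2, 1), (3, 1), (3, -1), (1, 2)}"
    proof cases
      case 1
      then have "y = 0 \<or> y = 1" by linarith
      with 1 show ?thesis by (auto simp: p)
    next
      case 2
      then have "y = 0 \<or> y = 1" by linarith
      with 2 show ?thesis by (auto simp: p)
    qed (simp_all add: p)
  qed
qed (simp add: zigzag_mem)

text \<open>
  The two added cells are those at the initial end (1, 0) of the strip; the glide reflection turns this
  extension into the standard one.
\<close>
lemma zigzag_glide:
  assumes "k \<ge> 1"
  shows "equivalent ({(0, 1), (1, -1)} \<union> zigzag k) (zigzag (Suc k))"
proof (rule equivalentI[OF symmetry_glide], rule set_eqI)
  fix p :: "int \<times> int"
  obtain x y where p: "p = (x, y)"
    by (cases p)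
  have "p \<in> (\<lambda>p. prod.swap p + (2, -1)) ` ({(0, 1), (1, -1)} \<union> zigzag k) \<longleftrightarrow>
      (y + 1, x - 2) \<in> {(0, 1), (1, -1)} \<union> zigzag k" (is "?L \<longleftrightarrow> ?R")
  proof
    show ?R if ?L
      using that by (auto simp: p)
    show ?L if ?R
      using that by (intro image_eqI[of _ _ "(y + 1, x - 2)"]) (auto simp: p)
  qed
  also have "\<dots> \<longleftrightarrow> p \<in> zigzag (Suc k)"
  proof -
    consider "x = y + 1" | "x = y + 2" | "x = y - 1" | "x = y + 4" | "x - y \<notin> {1, 2, -1, 4}"
      by force
    then show ?thesis
      using assms by cases (auto simp: p zigzag_mem)
  qed
  finally show "p \<in> (\<lambda>p. prod.swap p + (2, -1)) ` ({(0, 1), (1, -1)} \<union> zigzag k) \<longleftrightarrow> p \<in> zigzag (Suc k)" .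
qed

text \<open>
  At an inner cell there is no room for new cells, and at the two ends of the path the strip is
  continued. At a side leaf one new cell is adjacent to the position of the side leaf two levels up,
  the other to the position of the one two levels down. Both positions must be vacant, which bounds k
  by 4 and leaves four cases: sizes 4 and 6 lead to the next strip, and size 8 leads to the tripod.
\<close>
lemma sprout_zigzag:
  assumes k: "k \<ge> 1" and s: "lattice.sprout (zigzag k) v w1 w2"
  shows "equivalent (insert w1 (insert w2 (zigzag k))) (zigzag (Suc k)) \<or>
    k = 4 \<and> insert w1 (insert w2 (zigzag k)) = tripod"
proof -
  obtain x y where v: "v = (x, y)"
    by (cases v)
  have mem: "(x, y) \<in> zigzag k"
    using s unfolding lattice.sprout_def v by blast
  have new: "w \<notin> zigzag k" "\<And>q. q \<in> zigzag k \<Longrightarrow> adj w q \<Longrightarrow> q = (x, y)" if "w \<in> {w1, w2}" for w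
    using s that unfolding lattice.sprout_def v by blast+
  have positions: "{w1, w2} = {(x - a - b, y + a), (x + b, y - a - b)}"
    if "(x + a, y + b) \<in> zigzag k" "adj (x, y) (x + a, y + b)" for a b
  proof -
    have "{w1, w2} = {v + rot (rot ((x + a, y + b) - v)), v - rot ((x + a, y + b) - v)}"
      using sprout_positions[OF s that(1)] that(2) by (simp only: v)
    also have "v + rot (rot ((x + a, y + b) - v)) = (x - a - b, y + a)"
      by (simp add: v)
    also have "v - rot ((x + a, y + b) - v) = (x + b, y - a - b)"
      by (simp add: v)
    finally show ?thesis .
  qed
  have ins: "insert w1 (insert w2 (zigzag k)) = {w1, w2} \<union> zigzag k"
    by blast
  consider "x = y + 1" "2 \<le> x + y" "x + y \<le> int k" | "x = y + 2" "2 \<le> x + y" "x + y \<le> int k"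
    | "x = 1" "y = 0" | "x = y + 1" "x + y = int k + 1" | "x = y + 2" "x + y = int k + 1"
    | "x = y - 1" "2 \<le> x + y" "x + y \<le> int k" | "x = y + 4" "2 \<le> x + y" "x + y \<le> int k"
    using mem k unfolding zigzag_mem by (smt (verit))
  then show ?thesis
  proof cases
    case 1
    have "{w1, w2} = {(x - 1, y + 1), (x, y - 1)}"
      using positions[of 1 0] 1 by (simp add: zigzag_mem adj_pair)
    then have "(x - 1, y + 1) \<notin> zigzag k"
      by (intro new(1)) simp
    with 1 show ?thesis
      by (simp add: zigzag_mem)
  next
    case 2
    have "{w1, w2} = {(x + 1, y - 1), (x, y + 1)}"
      using positions[of "-1" 0] 2 by (simp add: zigzag_mem adj_pair)
    then have "(x + 1, y - 1) \<notin> zigzag k"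
      by (intro new(1)) simp
    with 2 show ?thesis
      by (simp add: zigzag_mem)
  next
    case 3
    have "{w1, w2} = {(0, 1), (1, -1)}"
      using positions[of 1 0] 3 k by (simp add: zigzag_mem adj_pair)
    then show ?thesis
      using zigzag_glide[OF k] by (simp add: ins)
  next
    case 4
    have "{w1, w2} = {(y + 2, y), (y, y + 1)}"
      using positions[of 0 "-1"] 4 k by (simp add: zigzag_mem adj_pair add.commute)
    moreover have "zigzag (Suc k) = insert (y + 2, y) (insert (y, y + 1) (zigzag k))"
      by (rule zigzag_Suc_even[OF _ k]) (use 4 in simp)
    ultimately show ?thesis
      by (simp add: ins equivalent_refl)
  next
    case 5
    have "{w1, w2} = {(y + 3, y - 1), (y + 2, y + 1)}"
      using positions[of "-1" 0] 5 k by (simp add: zigzag_mem adj_pair add.commute)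
    moreover have "zigzag (Suc k) = insert (y + 2, y + 1) (insert (y + 3, y - 1) (zigzag k))"
      by (rule zigzag_Suc_odd[OF _ k]) (use 5 in simp)
    ultimately show ?thesis
      by (simp add: ins equivalent_refl insert_commute)
  next
    case 6
    have pos: "{w1, w2} = {(x, y + 1), (x - 1, y)}"
      using positions[of 1 "-1"] 6 by (simp add: zigzag_mem adj_pair)
    have "(x + 1, y + 1) \<notin> zigzag k" "(x - 1, y - 1) \<notin> zigzag k"
      using new(2)[of "(x, y + 1)" "(x + 1, y + 1)"] new(2)[of "(x - 1, y)" "(x - 1, y - 1)"]
      unfolding pos by (auto simp: adj_pair)
    with 6 have "y = 2" "int k = 3 \<or> int k = 4"
      by (simp_all add: zigzag_mem) linarith+
    then have "y = 2" "x = 1" "k = 3 \<or> k = 4"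
      using 6(1) by linarith+
    then show ?thesis
    proof (elim disjE)
      assume "k = 4"
      have "insert w1 (insert w2 (zigzag k)) = tripod"
        unfolding ins unfolding pos \<open>x = 1\<close> \<open>y = 2\<close> \<open>k = 4\<close> tripod_def by (simp add: insert_commute)
      then show ?thesis
        using \<open>k = 4\<close> by blast
    next
      assume "k = 3"
      have "(\<lambda>p. rot (prod.swap p) + (4, -2)) ` {(1, 3), (0, 2), (1, 0), (2, 0), (2, 1), (3, 1), (3, -1), (1, 2)} = zigzag 4"
        by (simp add: zigzag_4) blast
      then have "(\<lambda>p. rot (prod.swap p) + (4, -2)) ` ({w1, w2} \<union> zigzag k) = zigzag (Suc k)"
        unfolding pos \<open>x = 1\<close> \<open>y = 2\<close> \<open>k = 3\<close> zigzag_3 by (simp add: insert_commute)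
      then show ?thesis
        unfolding ins using equivalentI[OF symmetry_reflection] by blast
    qed
  next
    case 7
    have pos: "{w1, w2} = {(x, y - 1), (x + 1, y)}"
      using positions[of "-1" 1] 7 by (simp add: zigzag_mem adj_pair add.commute)
    have "(x + 1, y + 1) \<notin> zigzag k" "(x - 1, y - 1) \<notin> zigzag k"
      using new(2)[of "(x + 1, y)" "(x + 1, y + 1)"] new(2)[of "(x, y - 1)" "(x - 1, y - 1)"]
      unfolding pos by (auto simp: adj_pair)
    with 7 have "y = -1" "int k = 2 \<or> int k = 3"
      by (simp_all add: zigzag_mem) linarith+
    then have "y = -1" "x = 3" "k = 2 \<or> k = 3"
      using 7(1) by linarith+
    then show ?thesis
    proof (elim disjE)
      assume "k = 2"
      have "(\<lambda>p. rot (rot p) + (4, -2)) ` {(3, -2), (4, -1), (1, 0), (2, 0), (2, 1), (3, -1)} = zigzag 3"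
        by (simp add: zigzag_3) blast
      then have "(\<lambda>p. rot (rot p) + (4, -2)) ` ({w1, w2} \<union> zigzag k) = zigzag (Suc k)"
        unfolding pos \<open>x = 3\<close> \<open>y = -1\<close> \<open>k = 2\<close> zigzag_2 by (simp add: insert_commute)
      then show ?thesis
        unfolding ins using equivalentI[OF symmetry_rotation] by blast
    next
      assume "k = 3"
      have "(\<lambda>p. rot (prod.swap p) + (4, -2)) `
          {(3, -2), (4, -1), (1, 0), (2, 0), (2, 1), (3, 1), (3, -1), (1, 2)} =
          {(0, 1), (1, -1), (1, 0), (2, 0), (2, 1), (3, 1), (3, -1), (1, 2)}"
        by simp blast
      then have "(\<lambda>p. rot (prod.swap p) + (4, -2)) ` ({w1, w2} \<union> zigzag k) = {(0, 1), (1, -1)} \<union> zigzag k"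
        unfolding pos \<open>x = 3\<close> \<open>y = -1\<close> \<open>k = 3\<close> zigzag_3 by (simp add: insert_commute)
      then show ?thesis
        unfolding ins using equivalentI[OF symmetry_reflection] equivalent_trans zigzag_glide[OF k] by blast
    qed
  qed
qed

text \<open>
  For each cell v the proof names a neighbour u in the tripod, one forced position w of a new cell, and
  where w itself is vacant, a cell q of the tripod other than v that is adjacent to w.
\<close>
lemma tripod_no_sprout: "\<not> lattice.sprout tripod v w1 w2"
proof
  assume s: "lattice.sprout tripod v w1 w2"
  have T: "tripod = {(0, 2), (1, 3), (1, 0), (2, 0), (2, 1), (3, 1), (3, 2), (3, -1), (1, 2), (4, 0)}"
    by (simp add: tripod_def zigzag_4)
  have mem: "v \<in> tripod" and new: "\<And>w q. w \<in> {w1, w2} \<Longrightarrow> w \<in> tripod \<or> q \<in> tripod \<and> adj w q \<Longrightarrow> q = v \<and> w \<notin> tripod"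
    using s unfolding lattice.sprout_def by blast+
  have blocked: False
    if "u \<in> tripod" "adj v u" "w = v + rot (rot (u - v)) \<or> w = v - rot (u - v)"
      "w \<in> tripod \<or> q \<in> tripod \<and> adj w q \<and> q \<noteq> v" for u w q
    using sprout_positions[OF s that(1,2)] new[of w q] that(3,4) by auto
  have "v = (0, 2) \<or> v = (1, 3) \<or> v = (1, 0) \<or> v = (2, 0) \<or> v = (2, 1) \<or> v = (3, 1) \<or> v = (3, 2) \<or>
      v = (3, -1) \<or> v = (1, 2) \<or> v = (4, 0)"
    using mem by (simp add: T)
  then show False
  proof (elim disjE)
    assume "v = (0, 2)" then show False
      by (intro blocked[of "(1, 2)" "(0, 1)" "(1, 0)"]) (simp_all add: T adj_pair)
  next
    assume "v = (1, 3)" then show False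
      by (intro blocked[of "(1, 2)" "(2, 3)" "(3, 2)"]) (simp_all add: T adj_pair)
  next
    assume "v = (1, 0)" then show False
      by (intro blocked[of "(2, 0)" "(0, 1)" "(0, 2)"]) (simp_all add: T adj_pair)
  next
    assume "v = (2, 0)" then show False
      by (intro blocked[of "(1, 0)" "(3, -1)"]) (simp_all add: T adj_pair)
  next
    assume "v = (2, 1)" then show False
      by (intro blocked[of "(2, 0)" "(3, 1)"]) (simp_all add: T adj_pair)
  next
    assume "v = (3, 1)" then show False
      by (intro blocked[of "(2, 1)" "(4, 0)"]) (simp_all add: T adj_pair)
  next
    assume "v = (3, 2)" then show False
      by (intro blocked[of "(3, 1)" "(2, 3)" "(1, 3)"]) (simp_all add: T adj_pair)
  next
    assume "v = (3, -1)" then show False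
      by (intro blocked[of "(2, 0)" "(4, -1)" "(4, 0)"]) (simp_all add: T adj_pair)
  next
    assume "v = (1, 2)" then show False
      by (intro blocked[of "(2, 1)" "(1, 3)"]) (simp_all add: T adj_pair)
  next
    assume "v = (4, 0)" then show False
      by (intro blocked[of "(3, 1)" "(4, -1)" "(3, -1)"]) (simp_all add: T adj_pair)
  qed
qed

lemma adjacent_pair_equivalent:
  assumes "adj p q"
  shows "equivalent {p, q} (zigzag 1)"
proof -
  define d where "d = q - p"
  have "d \<in> unit_steps"
    using assms by (simp add: adj_def d_def)
  have power: "lattice_symmetry (rot ^^ n)" for n
  proof (induction n)
    case 0
    show ?case
      using lattice_symmetry.id by (simp add: id_def)
  next
    case (Suc n)
    then show ?case
      using lattice_symmetry.rot by (simp add: o_def)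
  qed
  have "(rot ^^ 0) d = (1, 0) \<or> (rot ^^ 1) d = (1, 0) \<or> (rot ^^ 2) d = (1, 0) \<or>
      (rot ^^ 3) d = (1, 0) \<or> (rot ^^ 4) d = (1, 0) \<or> (rot ^^ 5) d = (1, 0)"
    using \<open>d \<in> unit_steps\<close> by (auto simp: unit_steps_def eval_nat_numeral)
  then obtain n where n: "(rot ^^ n) d = (1, 0)"
    by blast
  have zero: "(rot ^^ n) 0 = 0"
    by (induction n) (simp_all add: zero_prod_def)
  have "lattice_symmetry (\<lambda>r. (rot ^^ n) (r + - p) + (1, 0))"
    using lattice_symmetry_comp[OF power lattice_symmetry.shift[OF lattice_symmetry.id]]
    by (rule lattice_symmetry.shift)
  moreover have "(\<lambda>r. (rot ^^ n) (r + - p) + (1, 0)) ` {p, q} = zigzag 1"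
    using n zero unfolding zigzag_1 d_def by simp
  ultimately show ?thesis
    by (rule equivalentI)
qed

theorem cubic_tree_classification:
  assumes "k \<ge> 1" "lattice.cubic_tree V" "card V = 2 * k"
  shows "equivalent V (zigzag k) \<or> k = 5 \<and> equivalent V tripod"
  using assms
proof (induction k arbitrary: V rule: nat_induct_at_least)
  case base
  have tree: "graph_connected V adj" and "card V = 2"
    using base by (simp_all add: lattice.cubic_tree_def graph_tree_def)
  obtain p q where V: "V = {p, q}"
    using \<open>card V = 2\<close> unfolding card_2_iff by blast
  obtain w where "w \<in> V" "adj p w"
    by (rule lattice.connected_neighbour[OF tree, of p]) (simp_all add: V \<open>card V = 2\<close>[unfolded V])
  then have "adj p q"
    using lattice.irrefl[of p] by (cases "w = p") (simp_all add: V)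
  then show ?case
    unfolding V by (intro disjI1 adjacent_pair_equivalent)
next
  case (Suc k)
  have "card V \<ge> 4"
    using Suc.prems Suc.hyps by simp
  then obtain V' v w1 w2 where V: "V = insert w1 (insert w2 V')" and tree: "lattice.cubic_tree V'"
    and s: "lattice.sprout V' v w1 w2" and card: "card V = card V' + 2"
    by (rule lattice.cubic_tree_sprout[OF Suc.prems(1)])
  have "card V' = 2 * k"
    using Suc.prems(2) card by simp
  then consider g where "lattice_symmetry g" "g ` V' = zigzag k"
    | g where "lattice_symmetry g" "g ` V' = tripod"
    using Suc.IH[OF tree] unfolding equivalent_def by blast
  then show ?case
  proof cases
    case (1 g)
    have "lattice.sprout (zigzag k) (g v) (g w1) (g w2)"
      using sprout_image[OF s 1(1)] by (simp only: 1(2))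
    then have "equivalent (insert (g w1) (insert (g w2) (zigzag k))) (zigzag (Suc k)) \<or>
        k = 4 \<and> insert (g w1) (insert (g w2) (zigzag k)) = tripod"
      by (rule sprout_zigzag[OF Suc.hyps])
    moreover have "g ` V = insert (g w1) (insert (g w2) (zigzag k))"
      by (simp only: V image_insert 1(2))
    ultimately have "equivalent (g ` V) (zigzag (Suc k)) \<or> k = 4 \<and> g ` V = tripod"
      by (simp only:)
    moreover have "equivalent V (g ` V)"
      by (rule equivalentI[OF 1(1)]) (rule refl)
    ultimately show ?thesis
      using equivalent_trans[of V "g ` V"] by (elim disjE conjE) simp_all
  next
    case (2 g)
    have "lattice.sprout tripod (g v) (g w1) (g w2)"
      using sprout_image[OF s 2(1)] by (simp only: 2(2))
    then show ?thesis
      using tripod_no_sprout by blast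
  qed
qed

section \<open>The lattice in the plane\<close>
definition lattice_point :: "int \<times> int \<Rightarrow> complex" where
  "lattice_point p = of_int (fst p) + of_int (snd p) * \<omega>"

lemma omega_eq: "\<omega> = Complex (1 / 2) (sqrt 3 / 2)"
  by (simp add: \<omega>_def complex_eq_iff cos_60 sin_60)

lemma omega_square: "\<omega> * \<omega> = \<omega> - 1"
  by (simp add: omega_eq complex_eq_iff)

lemma cnj_omega: "cnj \<omega> = 1 - \<omega>"
  by (simp add: omega_eq complex_eq_iff)

lemma lattice_point_add: "lattice_point (p + q) = lattice_point p + lattice_point q"
  by (simp add: lattice_point_def algebra_simps)

lemma lattice_point_diff: "lattice_point (p - q) = lattice_point p - lattice_point q"
  by (simp add: lattice_point_def algebra_simps)

lemma lattice_point_rot: "lattice_point (rot p) = \<omega> * lattice_point p"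
proof (cases p)
  case (Pair x y)
  have "\<omega> * (of_int x + of_int y * \<omega>) = of_int x * \<omega> + of_int y * (\<omega> * \<omega>)"
    by (simp add: algebra_simps)
  then show ?thesis
    by (simp add: Pair lattice_point_def omega_square algebra_simps)
qed

lemma lattice_point_swap: "lattice_point (prod.swap p) = \<omega> * cnj (lattice_point p)"
proof (cases p)
  case (Pair x y)
  have "\<omega> * (of_int x + of_int y * (1 - \<omega>)) = of_int x * \<omega> + of_int y * \<omega> - of_int y * (\<omega> * \<omega>)"
    by (simp add: algebra_simps)
  then show ?thesis
    by (simp add: Pair lattice_point_def omega_square cnj_omega algebra_simps)
qed

lemma lattice_point_inner: "lattice_point (a, b) \<bullet> lattice_point (c, d) = a * c + b * d + (a * d + b * c) / 2"
proof -
  have "Re (lattice_point (x, y)) = x + y / 2" "Im (lattice_point (x, y)) = y / 2 * sqrt 3" for x y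
    by (simp_all add: lattice_point_def omega_eq)
  moreover have "(b / 2 * sqrt 3) * (d / 2 * sqrt 3) = b / 2 * (d / 2) * 3"
    by simp
  ultimately show ?thesis
    unfolding inner_complex_def by (simp only:) (simp add: field_simps)
qed

lemma norm_lattice_point: "(cmod (lattice_point (a, b)))\<^sup>2 = of_int (a * a + b * b + a * b)"
  by (simp add: power2_norm_eq_inner lattice_point_inner)

text \<open>Completing the square in either variable bounds both of them by 1 in absolute value.\<close>
lemma norm_form_le_one:
  fixes a b :: int
  assumes "a * a + b * b + a * b \<le> 1"
  shows "(a, b) = (0, 0) \<or> (a, b) \<in> unit_steps"
proof -
  have bound: "3 * d\<^sup>2 \<le> 4" if "c * c + d * d + c * d \<le> 1" for c d :: int
  proof -
    have "3 * d\<^sup>2 = 4 * (c * c + d * d + c * d) - (2 * c + d)\<^sup>2"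
      by (simp add: power2_eq_square algebra_simps)
    also have "\<dots> \<le> 4 * 1 - 0"
      using that by (intro diff_mono) auto
    finally show ?thesis by simp
  qed
  have "3 * b\<^sup>2 \<le> 4" "3 * a\<^sup>2 \<le> 4"
    using bound[of a b] bound[of b a] assms by (simp_all add: algebra_simps)
  moreover have "\<bar>c\<bar> \<le> 1" if "3 * c\<^sup>2 \<le> 4" for c :: int
  proof (rule ccontr)
    assume "\<not> \<bar>c\<bar> \<le> 1"
    then have "2\<^sup>2 \<le> \<bar>c\<bar>\<^sup>2"
      by (intro power_mono) auto
    with that show False by simp
  qed
  ultimately have "\<bar>a\<bar> \<le> 1" "\<bar>b\<bar> \<le> 1"
    by blast+
  then have "a = -1 \<or> a = 0 \<or> a = 1" "b = -1 \<or> b = 0 \<or> b = 1"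
    by linarith+
  then show ?thesis
    using assms by (elim disjE) (simp_all add: unit_steps_def)
qed

lemma norm_unit_step:
  assumes "d \<in> unit_steps"
  shows "cmod (lattice_point d) = 1"
proof (rule power2_eq_imp_eq)
  show "(cmod (lattice_point d))\<^sup>2 = 1\<^sup>2"
    using assms unfolding unit_steps_def by (elim insertE emptyE) (simp_all add: norm_lattice_point)
qed simp_all

lemma norm_omega: "cmod \<omega> = 1"
  using norm_unit_step[of "(0, 1)"] by (simp add: unit_steps_def lattice_point_def)

lemma lattice_point_eq_iff: "lattice_point p = lattice_point q \<longleftrightarrow> p = q"
proof
  assume "lattice_point p = lattice_point q"
  then have "(cmod (lattice_point (p - q)))\<^sup>2 = 0"
    by (simp add: lattice_point_diff)
  moreover obtain a b where ab: "p - q = (a, b)"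
    by (cases "p - q")
  ultimately have "a * a + b * b + a * b = 0"
    by (simp only: norm_lattice_point of_int_eq_0_iff)
  then have "(a, b) = (0, 0) \<or> (a, b) \<in> unit_steps" and "a * a + b * b + a * b = 0"
    using norm_form_le_one[of a b] by simp_all
  then have "(a, b) = (0, 0)"
    unfolding unit_steps_def by (elim disjE insertE emptyE) simp_all
  then show "p = q"
    using ab by (simp add: zero_prod_def[symmetric])
qed simp

lemma eisenstein_eq_range_lattice_point: "eisenstein = range lattice_point"
proof -
  have "eisenstein = {lattice_point (a, b) | a b. True}"
    by (simp add: eisenstein_def lattice_point_def)
  then show ?thesis
    by auto
qed

section \<open>Isometries and edges of polygons\<close>
definition isometry :: "(complex \<Rightarrow> complex) \<Rightarrow> bool" where
  "isometry f \<longleftrightarrow> (\<forall>x y. dist (f x) (f y) = dist x y)"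

lemma isometry_affine:
  assumes "isometry f"
  obtains L where "linear L" "inj L" "\<And>x. f x = f 0 + L x"
proof
  let ?L = "\<lambda>x. f x - f 0"
  have "orthogonal_transformation ?L"
    using assms by (simp add: orthogonal_transformation_isometry isometry_def dist_norm)
  then show "linear ?L" "inj ?L"
    by (simp_all add: orthogonal_transformation_linear orthogonal_transformation_inj)
qed simp

lemma isometry_image:
  assumes "linear L" "\<And>x. f x = a + L x"
  shows "f ` S = (+) a ` L ` S"
  using assms by (simp add: image_image)

lemma isometry_convex_hull:
  assumes "isometry f"
  shows "f ` (convex hull S) = convex hull (f ` S)"
proof -
  obtain L where L: "linear L" "\<And>x. f x = f 0 + L x"
    using isometry_affine[OF assms] by metis
  show ?thesis
    unfolding isometry_image[of L f, OF L] convex_hull_linear_image[OF L(1)] convex_hull_translation ..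
qed

lemma isometry_edge:
  assumes "isometry f"
  shows "f ` e edge_of f ` C \<longleftrightarrow> e edge_of C"
proof -
  obtain L where L: "linear L" "inj L" "\<And>x. f x = f 0 + L x"
    using isometry_affine[OF assms] by metis
  show ?thesis
    unfolding isometry_image[of L f, OF L(1,3)] edge_of_def
    by (simp add: face_of_linear_image[OF L(1,2)] aff_dim_translation_eq aff_dim_injective_linear_image[OF L(1,2)])
qed

lemma isometry_adjacent:
  assumes f: "isometry f"
  shows "adjacent (f ` C) (f ` D) \<longleftrightarrow> adjacent C D"
proof -
  have "inj f"
    using f unfolding isometry_def by (intro injI) (metis dist_eq_0_iff)
  have "(\<exists>e. e edge_of f ` C \<and> e edge_of f ` D) \<longleftrightarrow> (\<exists>e. e edge_of C \<and> e edge_of D)"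
  proof
    assume "\<exists>e. e edge_of f ` C \<and> e edge_of f ` D"
    then obtain e where e: "e edge_of f ` C" "e edge_of f ` D" by blast
    then obtain e' where "e = f ` e'"
      using edge_of_imp_subset by (metis subset_imageE)
    with e show "\<exists>e. e edge_of C \<and> e edge_of D"
      using isometry_edge[OF f] by blast
  next
    assume "\<exists>e. e edge_of C \<and> e edge_of D"
    then show "\<exists>e. e edge_of f ` C \<and> e edge_of f ` D"
      using isometry_edge[OF f] by blast
  qed
  then show ?thesis
    unfolding adjacent_def by (simp add: inj_image_eq_iff[OF \<open>inj f\<close>])
qed

text \<open>
  A face of the convex hull of a finite set S is spanned by the points of S that it contains.
\<close>
lemma face_of_finite_hull:
  fixes S :: "'a :: euclidean_space set"
  assumes "finite S" "\<And>x. x \<in> S \<Longrightarrow> a \<bullet> x \<le> b"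
  shows "(convex hull {x \<in> S. a \<bullet> x = b}) face_of (convex hull S)"
proof -
  let ?F = "(convex hull S) \<inter> {x. a \<bullet> x = b}"
  have "convex hull S \<subseteq> {x. a \<bullet> x \<le> b}"
    using assms(2) by (intro hull_minimal) (auto simp: convex_halfspace_le)
  then have face: "?F face_of (convex hull S)"
    by (intro face_of_Int_supporting_hyperplane_le) auto
  obtain S' where S': "S' \<subseteq> S" "?F = convex hull S'"
    using face_of_convex_hull_subset[OF finite_imp_compact[OF assms(1)] face] .
  have "S' \<subseteq> ?F"
    using hull_subset[of S' convex] by (simp only: S'(2))
  then have "S' \<subseteq> {x \<in> S. a \<bullet> x = b}"
    using S'(1) by blast
  then have "?F \<subseteq> convex hull {x \<in> S. a \<bullet> x = b}"
    unfolding S'(2) by (rule hull_mono)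
  moreover have "convex hull {x \<in> S. a \<bullet> x = b} \<subseteq> ?F"
    using hull_subset[of S convex] by (intro hull_minimal) (auto simp: convex_Int convex_hyperplane)
  ultimately show ?thesis
    using face by (simp add: subset_antisym)
qed

text \<open>
  Faces of a simplex are spanned by subsets of its vertices, and such a subset is recovered from the
  face as its set of extreme points. So a common edge is spanned by two common vertices.
\<close>
lemma simplex_common_edge:
  fixes S S' :: "'a :: euclidean_space set"
  assumes S: "\<not> affine_dependent S" and S': "\<not> affine_dependent S'"
  shows "(\<exists>e. e edge_of (convex hull S) \<and> e edge_of (convex hull S')) \<longleftrightarrow>
    (\<exists>a b. a \<noteq> b \<and> {a, b} \<subseteq> S \<inter> S')"
proof
  assume "\<exists>e. e edge_of (convex hull S) \<and> e edge_of (convex hull S')"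
  then obtain e where e: "e face_of (convex hull S)" "e face_of (convex hull S')" "aff_dim e = 1"
    by (auto simp: edge_of_def)
  obtain c where c: "c \<subseteq> S" "e = convex hull c"
    using e(1) unfolding face_of_convex_hull_affine_independent[OF S] by blast
  obtain c' where c': "c' \<subseteq> S'" "e = convex hull c'"
    using e(2) unfolding face_of_convex_hull_affine_independent[OF S'] by blast
  have ind: "\<not> affine_dependent c" "\<not> affine_dependent c'"
    using affine_dependent_subset[OF _ c(1)] affine_dependent_subset[OF _ c'(1)] S S' by blast+
  have "x \<in> c \<longleftrightarrow> x \<in> c'" for x
    using extreme_point_of_convex_hull_affine_independent[OF ind(1), of x]
      extreme_point_of_convex_hull_affine_independent[OF ind(2), of x]
    by (simp only: c(2)[symmetric] c'(2)[symmetric])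
  then have "c = c'"
    by blast
  have "card c = 2"
    using e(3) aff_dim_affine_independent[OF ind(1)] c(2) by (simp add: aff_dim_convex_hull)
  then show "\<exists>a b. a \<noteq> b \<and> {a, b} \<subseteq> S \<inter> S'"
    using c(1) c'(1) \<open>c = c'\<close> unfolding card_2_iff by blast
next
  assume "\<exists>a b. a \<noteq> b \<and> {a, b} \<subseteq> S \<inter> S'"
  then obtain a b where ab: "a \<noteq> b" "{a, b} \<subseteq> S" "{a, b} \<subseteq> S'"
    by blast
  have "(convex hull {a, b}) face_of (convex hull S)" "(convex hull {a, b}) face_of (convex hull S')"
    unfolding face_of_convex_hull_affine_independent[OF S] face_of_convex_hull_affine_independent[OF S']
    using ab(2,3) by blast+
  then have "(convex hull {a, b}) edge_of (convex hull S)" "(convex hull {a, b}) edge_of (convex hull S')"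
    using ab(1) by (simp_all add: edge_of_def aff_dim_convex_hull)
  then show "\<exists>e. e edge_of (convex hull S) \<and> e edge_of (convex hull S')"
    by blast
qed

text \<open>Of three collinear points one lies between the others, and the distances add up.\<close>
lemma equilateral_affine_independent:
  fixes a b c :: "'a :: euclidean_space"
  assumes "dist a b = r" "dist b c = r" "dist c a = r" "r > 0"
  shows "\<not> affine_dependent {a, b, c}"
proof
  have ne: "a \<noteq> b" "b \<noteq> c" "a \<noteq> c"
    using assms by auto
  have dist: "dist b a = r" "dist c b = r" "dist a c = r"
    using assms by (simp_all add: dist_commute)
  assume "affine_dependent {a, b, c}"
  then have "collinear {a, b, c}"
    using collinear_3_eq_affine_dependent by blast
  then show False
    unfolding collinear_between_cases between using assms dist by (elim disjE) simp_all
qed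

section \<open>Hexagonal cells\<close>
definition hex_cell :: "int \<times> int \<Rightarrow> complex set" where
  "hex_cell p = hexagon ((1 + \<omega>) * lattice_point p)"

lemma hexagon_eq: "hexagon c = convex hull ((\<lambda>d. c + lattice_point d) ` unit_steps)"
proof -
  have p2: "\<omega> ^ 2 = \<omega> - 1"
    by (simp add: power2_eq_square omega_square)
  have p3: "\<omega> ^ 3 = -1"
    by (simp add: power3_eq_cube omega_square left_diff_distrib)
  have "\<omega> ^ 4 = \<omega> ^ 3 * \<omega>" "\<omega> ^ 5 = \<omega> ^ 3 * \<omega> ^ 2"
    by (simp_all add: eval_nat_numeral)
  then have p45: "\<omega> ^ 4 = - \<omega>" "\<omega> ^ 5 = 1 - \<omega>"
    by (simp_all add: p2 p3)
  have "{..<6 :: nat} = {0, 1, 2, 3, 4, 5}"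
    by auto
  moreover have "{c + \<omega> ^ j | j. j < 6} = (\<lambda>j. c + \<omega> ^ j) ` {..<6}"
    by blast
  ultimately have "{c + \<omega> ^ j | j. j < 6} = (\<lambda>j. c + \<omega> ^ j) ` {0, 1, 2, 3, 4, 5}"
    by (simp only:)
  also have "\<dots> = (\<lambda>d. c + lattice_point d) ` unit_steps"
    by (simp add: unit_steps_def lattice_point_def p2 p3 p45)
  finally show ?thesis
    by (simp add: hexagon_def)
qed

lemma hexagon_subset_cball: "hexagon c \<subseteq> cball c 1"
  unfolding hexagon_eq by (intro hull_minimal) (auto simp: dist_norm norm_unit_step)

lemma centre_in_hexagon: "c \<in> hexagon c"
proof -
  have "c + lattice_point (1, 0) \<in> hexagon c" "c + lattice_point (-1, 0) \<in> hexagon c"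
    unfolding hexagon_eq by (intro hull_inc imageI; simp add: unit_steps_def)+
  then have "midpoint (c + lattice_point (1, 0)) (c + lattice_point (-1, 0)) \<in> hexagon c"
    unfolding hexagon_def by (intro midpoints_in_convex_hull)
  then show ?thesis
    by (simp add: midpoint_def lattice_point_def scaleR_conv_of_real)
qed

lemma norm_hex_scale: "(cmod (1 + \<omega>))\<^sup>2 = 3"
  using norm_lattice_point[of 1 1] by (simp add: lattice_point_def)

text \<open>
  A hexagon lies in the unit disc around its centre, and the distance of two centres that are more than
  one step apart is at least 3.
\<close>
lemma hex_cell_meet:
  assumes "hex_cell p \<inter> hex_cell q \<noteq> {}"
  shows "p = q \<or> adj p q"
proof -
  obtain z where "z \<in> hex_cell p" "z \<in> hex_cell q"
    using assms by blast
  then have "dist ((1 + \<omega>) * lattice_point p) z \<le> 1" "dist ((1 + \<omega>) * lattice_point q) z \<le> 1"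
    using hexagon_subset_cball unfolding hex_cell_def by (auto simp: subset_iff)
  then have "dist ((1 + \<omega>) * lattice_point q) ((1 + \<omega>) * lattice_point p) \<le> 2"
    by (smt (verit) dist_commute dist_triangle)
  then have "cmod ((1 + \<omega>) * lattice_point (q - p)) \<le> 2"
    by (simp add: dist_norm lattice_point_diff right_diff_distrib)
  then have "(cmod ((1 + \<omega>) * lattice_point (q - p)))\<^sup>2 \<le> 2\<^sup>2"
    by (intro power_mono) auto
  then have "3 * (cmod (lattice_point (q - p)))\<^sup>2 \<le> 4"
    by (simp add: norm_mult power_mult_distrib norm_hex_scale)
  moreover obtain a b where ab: "q - p = (a, b)"
    by (cases "q - p")
  ultimately have "3 * of_int (a * a + b * b + a * b) \<le> (4 :: real)"
    by (simp only: norm_lattice_point)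
  then have "real_of_int (3 * (a * a + b * b + a * b)) \<le> real_of_int 4"
    by simp
  then have "3 * (a * a + b * b + a * b) \<le> 4"
    by (simp only: of_int_le_iff)
  moreover have "3 * n \<le> 4 \<Longrightarrow> n \<le> 1" for n :: int
    by linarith
  ultimately have "a * a + b * b + a * b \<le> 1"
    by blast
  then show ?thesis
    using norm_form_le_one[of a b] ab by (auto simp: adj_def zero_prod_def[symmetric])
qed

lemma hex_cell_eq_iff: "hex_cell p = hex_cell q \<longleftrightarrow> p = q"
proof
  assume eq: "hex_cell p = hex_cell q"
  have "(1 + \<omega>) * lattice_point p \<in> hex_cell q"
    using centre_in_hexagon unfolding eq[symmetric] unfolding hex_cell_def .
  then have "dist ((1 + \<omega>) * lattice_point q) ((1 + \<omega>) * lattice_point p) \<le> 1"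
    using hexagon_subset_cball unfolding hex_cell_def mem_cball[symmetric] by blast
  then have "cmod ((1 + \<omega>) * lattice_point (q - p)) \<le> 1"
    by (simp add: dist_norm lattice_point_diff right_diff_distrib)
  then have "(cmod ((1 + \<omega>) * lattice_point (q - p)))\<^sup>2 \<le> 1\<^sup>2"
    by (intro power_mono) auto
  then have "3 * (cmod (lattice_point (q - p)))\<^sup>2 \<le> 1"
    by (simp add: norm_mult power_mult_distrib norm_hex_scale)
  then have "q - p \<notin> unit_steps"
    using norm_unit_step by fastforce
  then show "p = q"
    using hex_cell_meet[of p q] eq centre_in_hexagon unfolding hex_cell_def adj_def by fastforce
qed simp

text \<open>
  Among the six vectors from the centre to the vertices, d and rot d are those that maximise the inner
  product with d + rot d; the maximum is 3/2.
\<close>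
lemma hex_edge:
  assumes d: "d \<in> unit_steps"
  shows "(convex hull {c + lattice_point d, c + lattice_point (rot d)}) edge_of hexagon c"
proof -
  let ?w = "lattice_point d + lattice_point (rot d)"
  have products: "\<forall>d\<in>unit_steps. \<forall>u\<in>unit_steps.
      (lattice_point d + lattice_point (rot d)) \<bullet> lattice_point u \<le> 3 / 2 \<and>
      ((lattice_point d + lattice_point (rot d)) \<bullet> lattice_point u = 3 / 2 \<longleftrightarrow> u = d \<or> u = rot d)"
    by (simp add: unit_steps_def inner_add_left lattice_point_inner)
  have "rot d \<in> unit_steps" "d \<noteq> rot d"
    using d by (auto simp: unit_steps_def)
  have "(convex hull {x \<in> (\<lambda>d. c + lattice_point d) ` unit_steps. ?w \<bullet> x = ?w \<bullet> c + 3 / 2}) face_of hexagon c"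
    unfolding hexagon_eq
  proof (rule face_of_finite_hull)
    show "finite ((\<lambda>d. c + lattice_point d) ` unit_steps)"
      by (simp add: unit_steps_def)
  next
    fix x
    assume "x \<in> (\<lambda>d. c + lattice_point d) ` unit_steps"
    then show "?w \<bullet> x \<le> ?w \<bullet> c + 3 / 2"
      using products d by (auto simp: inner_add_right)
  qed
  moreover have "{x \<in> (\<lambda>d. c + lattice_point d) ` unit_steps. ?w \<bullet> x = ?w \<bullet> c + 3 / 2} = {c + lattice_point d, c + lattice_point (rot d)}"
  proof -
    have "{x \<in> (\<lambda>d. c + lattice_point d) ` unit_steps. ?w \<bullet> x = ?w \<bullet> c + 3 / 2} =
        (\<lambda>d. c + lattice_point d) ` {u \<in> unit_steps. ?w \<bullet> (c + lattice_point u) = ?w \<bullet> c + 3 / 2}"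
      by blast
    also have "{u \<in> unit_steps. ?w \<bullet> (c + lattice_point u) = ?w \<bullet> c + 3 / 2} = {d, rot d}"
      using products d \<open>rot d \<in> unit_steps\<close> unfolding inner_add_right by force
    finally show ?thesis
      by simp
  qed
  ultimately show ?thesis
    using \<open>d \<noteq> rot d\<close> by (simp add: edge_of_def aff_dim_convex_hull lattice_point_eq_iff)
qed

text \<open>
  The edge between the vertices c + d and c + rot d of the hexagon around c belongs also to the hexagon
  around c + d + rot d, where it lies opposite and is given by the step - d.
\<close>
lemma hex_cell_adjacent: "adjacent (hex_cell p) (hex_cell q) \<longleftrightarrow> adj p q"
proof
  assume "adjacent (hex_cell p) (hex_cell q)"
  then obtain e where "hex_cell p \<noteq> hex_cell q" "e edge_of hex_cell p" "e edge_of hex_cell q"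
    unfolding adjacent_def by blast
  moreover from this have "e \<noteq> {}"
    by (auto simp: edge_of_def)
  ultimately show "adj p q"
    using hex_cell_meet[of p q] edge_of_imp_subset by blast
next
  assume "adj p q"
  define d where "d = q - p"
  define c where "c = (1 + \<omega>) * lattice_point p"
  have d: "d \<in> unit_steps"
    using \<open>adj p q\<close> by (simp add: adj_def d_def)
  have q: "(1 + \<omega>) * lattice_point q = c + lattice_point d + lattice_point (rot d)"
    by (simp add: c_def d_def lattice_point_diff lattice_point_rot algebra_simps)
  have minus: "lattice_point (- d) = - lattice_point d" "rot (- d) = - rot d" "lattice_point (- rot d) = - lattice_point (rot d)"
    using lattice_point_diff[of 0 d] lattice_point_diff[of 0 "rot d"] by (cases d; simp add: lattice_point_def zero_prod_def)+
  have "(convex hull {c + lattice_point d, c + lattice_point (rot d)}) edge_of hex_cell p"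
    using hex_edge[OF d] by (simp add: hex_cell_def c_def)
  moreover have "(convex hull {c + lattice_point d, c + lattice_point (rot d)}) edge_of hex_cell q"
  proof -
    have "c + lattice_point d + lattice_point (rot d) + lattice_point (- d) = c + lattice_point (rot d)"
      "c + lattice_point d + lattice_point (rot d) + lattice_point (rot (- d)) = c + lattice_point d"
      by (simp_all add: minus)
    then show ?thesis
      using hex_edge[OF uminus_unit_steps[OF d], of "c + lattice_point d + lattice_point (rot d)"]
      by (simp only: hex_cell_def q insert_commute)
  qed
  moreover have "p \<noteq> q"
    using \<open>adj p q\<close> lattice.irrefl by blast
  ultimately show "adjacent (hex_cell p) (hex_cell q)"
    unfolding adjacent_def hex_cell_eq_iff by blast
qed

lemma hex_tiling_eq: "hex_tiling = range hex_cell"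
  by (auto simp: hex_tiling_def hex_cell_def eisenstein_eq_range_lattice_point)

section \<open>Triangular cells\<close>

text \<open>
  The centres of the triangles, rescaled, are the points of the honeycomb. The vertices of the triangle
  with centre p then are the neighbours of p in the removed colour class. This makes the compatibility
  of triangles with lattice symmetries evident.
\<close>
definition corners :: "int \<times> int \<Rightarrow> (int \<times> int) set" where
  "corners p = {q. adj p q \<and> q \<notin> honeycomb}"

text \<open>
  The removed colour class is the ideal generated by 2 - \<open>\<omega>\<close>. As (1 + \<open>\<omega>\<close>) (2 - \<open>\<omega>\<close>) = 3, this
  factor maps it onto the Eisenstein lattice.
\<close>
definition tri_scale :: complex where
  "tri_scale = (1 + \<omega>) / 3"

definition tri_cell :: "int \<times> int \<Rightarrow> complex set" where
  "tri_cell p = convex hull ((\<lambda>q. tri_scale * lattice_point q) ` corners p)"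

lemma honeycomb_iff: "(x, y) \<in> honeycomb \<longleftrightarrow> \<not> 3 dvd (x - y)"
  by (simp add: honeycomb_def)

lemma adj_iff_mem:
  "adj (x, y) q \<longleftrightarrow> q \<in> {(x + 1, y), (x, y + 1), (x - 1, y + 1), (x - 1, y), (x, y - 1), (x + 1, y - 1)}"
  by (cases q) (simp add: adj_pair)

text \<open>
  With z = a + b \<open>\<omega>\<close>, the points (2 - \<open>\<omega>\<close>) z + 1 and (2 - \<open>\<omega>\<close>) z + 2 are the rescaled centres of the upward
  and of the downward triangle in the lozenge at z.
\<close>
lemma corners_up: "corners (2 * a + b + 1, b - a) = {(2 * a + b, b - a), (2 * a + b + 1, b - a + 1), (2 * a + b + 2, b - a - 1)}"
proof -
  have "\<not> 3 dvd (3 * a + 1)" "\<not> 3 dvd (3 * a + 2)" "\<not> 3 dvd (3 * a - 1)"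
    by presburger+
  then show ?thesis
    unfolding corners_def adj_iff_mem
    by (intro set_eqI iffI; elim CollectE conjE insertE emptyE; simp add: honeycomb_iff algebra_simps)
qed

lemma corners_down: "corners (2 * a + b + 2, b - a) = {(2 * a + b + 3, b - a), (2 * a + b + 1, b - a + 1), (2 * a + b + 2, b - a - 1)}"
proof -
  have "\<not> 3 dvd (3 * a + 1)" "\<not> 3 dvd (3 * a + 2)" "\<not> 3 dvd (3 * a + 4)"
    by presburger+
  moreover have "3 dvd (3 * a + 3)"
    by presburger
  ultimately show ?thesis
    unfolding corners_def adj_iff_mem
    by (intro set_eqI iffI; elim CollectE conjE insertE emptyE; simp add: honeycomb_iff algebra_simps)
qed

lemma honeycomb_cases:
  assumes "p \<in> honeycomb"
  obtains a b where "p = (2 * a + b + 1, b - a)" | a b where "p = (2 * a + b + 2, b - a)"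
proof -
  obtain x y where p: "p = (x, y)"
    by (cases p)
  have "(x - y) mod 3 = 1 \<or> (x - y) mod 3 = 2"
    using assms unfolding p honeycomb_iff by presburger
  then obtain m where "x - y = 3 * m + 1 \<or> x - y = 3 * m + 2"
    by (metis mult_div_mod_eq)
  then have "p = (2 * m + (m + y) + 1, (m + y) - m) \<or> p = (2 * m + (m + y) + 2, (m + y) - m)"
    by (auto simp: p)
  then show ?thesis
    using that by blast
qed

lemma tri_scale_corner: "tri_scale * lattice_point (2 * a + b, b - a) = lattice_point (a, b)"
proof -
  have "(1 + \<omega>) * lattice_point (2 * a + b, b - a) =
      of_int (2 * a + b) + of_int (b + 2 * a + (b - a)) * \<omega> + of_int (b - a) * (\<omega> * \<omega>)"
    by (simp add: lattice_point_def algebra_simps)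
  also have "\<dots> = 3 * lattice_point (a, b)"
    by (simp add: omega_square lattice_point_def algebra_simps)
  finally show ?thesis
    by (simp add: tri_scale_def)
qed

lemma tri_vertices_up:
  "(\<lambda>q. tri_scale * lattice_point q) ` corners (2 * a + b + 1, b - a) =
     {lattice_point (a, b), lattice_point (a + 1, b), lattice_point (a, b + 1)}"
proof -
  have "corners (2 * a + b + 1, b - a) =
      {(2 * a + b, b - a), (2 * (a + 1) + b, b - (a + 1)), (2 * a + (b + 1), (b + 1) - a)}"
    unfolding corners_up by (simp add: insert_commute algebra_simps)
  then show ?thesis
    by (simp only: image_insert image_empty tri_scale_corner)
qed

lemma tri_vertices_down:
  "(\<lambda>q. tri_scale * lattice_point q) ` corners (2 * a + b + 2, b - a) =
     {lattice_point (a + 1, b), lattice_point (a, b + 1), lattice_point (a + 1, b + 1)}"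
proof -
  have "corners (2 * a + b + 2, b - a) =
      {(2 * (a + 1) + b, b - (a + 1)), (2 * a + (b + 1), (b + 1) - a), (2 * (a + 1) + (b + 1), (b + 1) - (a + 1))}"
    unfolding corners_down by (simp add: insert_commute algebra_simps)
  then show ?thesis
    by (simp only: image_insert image_empty tri_scale_corner)
qed

lemma tri_cell_up:
  "tri_cell (2 * a + b + 1, b - a) =
     convex hull {lattice_point (a, b), lattice_point (a, b) + 1, lattice_point (a, b) + \<omega>}"
  unfolding tri_cell_def tri_vertices_up by (simp add: lattice_point_def algebra_simps)

lemma tri_cell_down:
  "tri_cell (2 * a + b + 2, b - a) =
     convex hull {lattice_point (a, b) + 1, lattice_point (a, b) + \<omega>, lattice_point (a, b) + 1 + \<omega>}"
  unfolding tri_cell_def tri_vertices_down by (simp add: lattice_point_def algebra_simps)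

lemma tri_tiling_eq: "tri_tiling = tri_cell ` honeycomb"
proof
  show "tri_tiling \<subseteq> tri_cell ` honeycomb"
  proof
    fix C
    assume "C \<in> tri_tiling"
    then obtain z where z: "z \<in> eisenstein"
      "C = convex hull {z, z + 1, z + \<omega>} \<or> C = convex hull {z + 1, z + \<omega>, z + 1 + \<omega>}"
      unfolding tri_tiling_def by blast
    then obtain a b where "z = lattice_point (a, b)"
      unfolding eisenstein_eq_range_lattice_point by auto
    then have "C = tri_cell (2 * a + b + 1, b - a) \<or> C = tri_cell (2 * a + b + 2, b - a)"
      using z(2) by (simp only: tri_cell_up tri_cell_down)
    moreover have "(2 * a + b + 1, b - a) \<in> honeycomb" "(2 * a + b + 2, b - a) \<in> honeycomb"
      unfolding honeycomb_iff by presburger+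
    ultimately show "C \<in> tri_cell ` honeycomb"
      by blast
  qed
  show "tri_cell ` honeycomb \<subseteq> tri_tiling"
  proof
    fix C
    assume "C \<in> tri_cell ` honeycomb"
    then obtain p where "p \<in> honeycomb" "C = tri_cell p"
      by blast
    then obtain a b where "C = tri_cell (2 * a + b + 1, b - a) \<or> C = tri_cell (2 * a + b + 2, b - a)"
      using honeycomb_cases by metis
    then show "C \<in> tri_tiling"
      unfolding tri_tiling_def tri_cell_up tri_cell_down eisenstein_eq_range_lattice_point by blast
  qed
qed

lemma corners_independent:
  assumes "p \<in> honeycomb"
  shows "\<not> affine_dependent ((\<lambda>q. tri_scale * lattice_point q) ` corners p)"
proof -
  have unit: "dist (lattice_point u) (lattice_point v) = 1" if "u - v \<in> unit_steps" for u v
    using norm_unit_step[OF that] by (simp add: dist_norm lattice_point_diff)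
  show ?thesis
    using assms
  proof (cases rule: honeycomb_cases)
    case (1 a b)
    show ?thesis
      unfolding 1 tri_vertices_up
      by (rule equilateral_affine_independent[of _ _ 1]) (simp_all add: unit unit_steps_def)
  next
    case (2 a b)
    show ?thesis
      unfolding 2 tri_vertices_down
      by (rule equilateral_affine_independent[of _ _ 1]) (simp_all add: unit unit_steps_def)
  qed
qed

text \<open>A triangle is determined by its vertices because p is the mean of its three corners.\<close>
lemma corners_eq_iff:
  assumes "p \<in> honeycomb" "q \<in> honeycomb"
  shows "corners p = corners q \<longleftrightarrow> p = q"
proof -
  have "\<Sum>(corners r) = r + r + r" if "r \<in> honeycomb" for r
    using that
  proof (cases rule: honeycomb_cases)
    case (1 a b)
    show ?thesis
      unfolding 1 corners_up by simp
  next
    case (2 a b)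
    show ?thesis
      unfolding 2 corners_down by simp
  qed
  then have "p + p + p = q + q + q" if "corners p = corners q"
    using assms that by metis
  moreover have "p + p + p = q + q + q \<Longrightarrow> p = q"
    by (simp add: prod_eq_iff)
  ultimately show ?thesis
    by blast
qed

text \<open>
  The common neighbours of p and q = p + d are p + rot d and p + d - rot d. They have the same colour,
  which is the third one besides those of p and q.
\<close>
lemma adj_common_corners:
  assumes "p \<in> honeycomb" "q \<in> honeycomb" "adj p q"
  obtains a b where "a \<noteq> b" "{a, b} \<subseteq> corners p \<inter> corners q"
proof -
  define d where "d = q - p"
  have d: "d \<in> unit_steps"
    using assms(3) by (simp add: adj_def d_def)
  have steps: "\<forall>d\<in>unit_steps. rot d \<in> unit_steps \<and> rot d - d \<in> unit_steps \<and> d - rot d \<in> unit_steps \<and>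
      - rot d \<in> unit_steps \<and> rot d \<noteq> d - rot d \<and> \<not> 3 dvd (fst d - snd d)"
    by (simp add: unit_steps_def)
  obtain x y u v where xy: "p = (x, y)" "d = (u, v)"
    by (cases p; cases d)
  have q: "q = (x + u, y + v)"
    using xy by (simp add: d_def prod_eq_iff)
  have "\<not> 3 dvd (x - y)" "\<not> 3 dvd (x + u - (y + v))" "\<not> 3 dvd (u - v)"
    using assms steps d unfolding q xy honeycomb_iff by force+
  then have "p + rot d \<notin> honeycomb" "p + (d - rot d) \<notin> honeycomb"
    unfolding xy by (simp_all add: honeycomb_iff) presburger+
  moreover have "adj p (p + rot d)" "adj p (p + (d - rot d))" "adj q (p + rot d)" "adj q (p + (d - rot d))"
  proof -
    have "p + rot d - p = rot d" "p + (d - rot d) - p = d - rot d"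
      "p + rot d - q = rot d - d" "p + (d - rot d) - q = - rot d"
      by (simp_all add: d_def)
    then show "adj p (p + rot d)" "adj p (p + (d - rot d))" "adj q (p + rot d)" "adj q (p + (d - rot d))"
      unfolding adj_def using steps d by metis+
  qed
  moreover have "p + rot d \<noteq> p + (d - rot d)"
    using steps d by auto
  ultimately show ?thesis
    using that[of "p + rot d" "p + (d - rot d)"] by (simp add: corners_def)
qed

text \<open>
  The corners a and b have the same colour, so they are not adjacent. A difference of two non-adjacent
  points at distance one from p arises from at most two such pairs of steps, so that p and q are equal
  or adjacent.
\<close>
lemma common_corners_adj:
  assumes "a \<noteq> b" "{a, b} \<subseteq> corners p \<inter> corners q"
  shows "p = q \<or> adj p q"
proof -
  have steps: "\<forall>d\<in>unit_steps. \<forall>d'\<in>unit_steps. \<forall>e\<in>unit_steps.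
      e - d + d' \<in> unit_steps \<and> d \<noteq> d' \<and> d - d' \<notin> unit_steps \<longrightarrow> d = e \<or> d - e \<in> unit_steps"
    by (simp add: unit_steps_def)
  have "a \<notin> honeycomb" "b \<notin> honeycomb"
    using assms(2) by (auto simp: corners_def)
  then have "3 dvd ((fst a - snd a) - (fst b - snd b))"
    by (simp add: honeycomb_def case_prod_unfold dvd_diff del: diff_diff_eq diff_diff_eq2)
  then have "3 dvd (fst (a - b) - snd (a - b))"
    by (simp add: algebra_simps)
  moreover have "\<forall>d\<in>unit_steps. \<not> 3 dvd (fst d - snd d)"
    by (simp add: unit_steps_def)
  ultimately have "a - b \<notin> unit_steps"
    by blast
  moreover have "a - p \<in> unit_steps" "b - p \<in> unit_steps" "a - q \<in> unit_steps" "b - q \<in> unit_steps"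
    using assms(2) by (simp_all add: corners_def adj_def)
  moreover have "(a - q) - (a - p) + (b - p) = b - q" "(a - p) - (b - p) = a - b" "(a - p) - (a - q) = q - p"
    by simp_all
  ultimately have "a - p = a - q \<or> q - p \<in> unit_steps"
    using steps assms(1) by (metis diff_left_imp_eq diff_add_cancel)
  then show ?thesis
    by (auto simp: adj_def)
qed


lemma inj_tri_scale: "inj (\<lambda>q. tri_scale * lattice_point q)"
proof (rule injI)
  fix p q
  assume eq: "tri_scale * lattice_point p = tri_scale * lattice_point q"
  have "1 + \<omega> \<noteq> 0"
    by (simp add: omega_eq complex_eq_iff)
  with eq show "p = q"
    by (simp add: tri_scale_def lattice_point_eq_iff)
qed

lemma tri_cell_eq_iff:
  assumes "p \<in> honeycomb" "q \<in> honeycomb"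
  shows "tri_cell p = tri_cell q \<longleftrightarrow> p = q"
proof
  assume eq: "tri_cell p = tri_cell q"
  let ?m = "\<lambda>q. tri_scale * lattice_point q"
  have "x \<in> ?m ` corners p \<longleftrightarrow> x \<in> ?m ` corners q" for x
    using extreme_point_of_convex_hull_affine_independent[OF corners_independent[OF assms(1)], of x]
      extreme_point_of_convex_hull_affine_independent[OF corners_independent[OF assms(2)], of x] eq
    by (simp only: tri_cell_def)
  then have "?m ` corners p = ?m ` corners q"
    by blast
  then show "p = q"
    using corners_eq_iff[OF assms] by (simp only: inj_image_eq_iff[OF inj_tri_scale])
qed simp

lemma tri_cell_adjacent:
  assumes "p \<in> honeycomb" "q \<in> honeycomb"
  shows "adjacent (tri_cell p) (tri_cell q) \<longleftrightarrow> adj p q"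
proof -
  let ?m = "\<lambda>q. tri_scale * lattice_point q"
  have "(\<exists>e. e edge_of tri_cell p \<and> e edge_of tri_cell q) \<longleftrightarrow>
      (\<exists>a b. a \<noteq> b \<and> {a, b} \<subseteq> ?m ` corners p \<inter> ?m ` corners q)"
    unfolding tri_cell_def
    by (rule simplex_common_edge) (intro corners_independent assms)+
  also have "\<dots> \<longleftrightarrow> (\<exists>a b. a \<noteq> b \<and> {a, b} \<subseteq> corners p \<inter> corners q)"
  proof -
    have "(\<exists>a b. a \<noteq> b \<and> {a, b} \<subseteq> ?m ` I) \<longleftrightarrow> (\<exists>a b. a \<noteq> b \<and> {a, b} \<subseteq> I)" for I
    proof
      assume "\<exists>a b. a \<noteq> b \<and> {a, b} \<subseteq> ?m ` I"
      then obtain a b where "?m a \<noteq> ?m b" "a \<in> I" "b \<in> I"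
        by blast
      then have "a \<noteq> b \<and> {a, b} \<subseteq> I"
        by blast
      then show "\<exists>a b. a \<noteq> b \<and> {a, b} \<subseteq> I"
        by blast
    next
      assume "\<exists>a b. a \<noteq> b \<and> {a, b} \<subseteq> I"
      then obtain a b where "a \<noteq> b" "a \<in> I" "b \<in> I"
        by blast
      then have "?m a \<noteq> ?m b \<and> {?m a, ?m b} \<subseteq> ?m ` I"
        using injD[OF inj_tri_scale, of a b] by blast
      then show "\<exists>a b. a \<noteq> b \<and> {a, b} \<subseteq> ?m ` I"
        by blast
    qed
    then show ?thesis
      by (simp only: image_Int[OF inj_tri_scale, symmetric])
  qed
  finally have "adjacent (tri_cell p) (tri_cell q) \<longleftrightarrow>
      p \<noteq> q \<and> (\<exists>a b. a \<noteq> b \<and> {a, b} \<subseteq> corners p \<inter> corners q)"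
    unfolding adjacent_def tri_cell_eq_iff[OF assms] by blast
  also have "\<dots> \<longleftrightarrow> adj p q"
    using common_corners_adj adj_common_corners[OF assms] lattice.irrefl by metis
  finally show ?thesis .
qed

section \<open>Symmetries of the tilings\<close>
lemma isometry_comp: "isometry f \<Longrightarrow> isometry g \<Longrightarrow> isometry (\<lambda>z. f (g z))"
  by (simp add: isometry_def)

lemma isometry_add: "isometry (\<lambda>z. z + c)"
  by (simp add: isometry_def)

lemma isometry_mult: "cmod u = 1 \<Longrightarrow> isometry (\<lambda>z. u * z)"
  by (simp add: isometry_def dist_norm right_diff_distrib[symmetric] norm_mult)

lemma isometry_cnj: "isometry cnj"
  by (simp add: isometry_def dist_norm complex_cnj_diff[symmetric] del: complex_cnj_diff)

text \<open>
  For the swap, the reflection z \<mapsto> \<open>\<omega>\<close> cnj z of the lattice is conjugated with the multiplication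
  by s.
\<close>
lemma realise_symmetry:
  assumes "lattice_symmetry g" "s \<noteq> 0"
  obtains f where "isometry f" "\<And>p. f (s * lattice_point p) = s * lattice_point (g p)"
proof -
  have "\<exists>f. isometry f \<and> (\<forall>p. f (s * lattice_point p) = s * lattice_point (g p))"
    using assms(1)
  proof induction
    case id
    show ?case
      by (intro exI[of _ "\<lambda>z. z"]) (simp add: isometry_def)
  next
    case (shift g t)
    then obtain f where "isometry f" "\<forall>p. f (s * lattice_point p) = s * lattice_point (g p)"
      by blast
    then show ?case
      by (intro exI[of _ "\<lambda>z. f z + s * lattice_point t"])
        (simp add: isometry_comp[OF isometry_add] lattice_point_add distrib_left)
  next
    case (rot g)
    then obtain f where "isometry f" "\<forall>p. f (s * lattice_point p) = s * lattice_point (g p)"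
      by blast
    then show ?case
      by (intro exI[of _ "\<lambda>z. \<omega> * f z"])
        (simp add: isometry_comp[OF isometry_mult[OF norm_omega]] lattice_point_rot)
  next
    case (swap g)
    then obtain f where f: "isometry f" "\<forall>p. f (s * lattice_point p) = s * lattice_point (g p)"
      by blast
    have "cmod (s * \<omega> / cnj s) = 1"
      using assms(2) by (simp add: norm_mult norm_divide norm_omega)
    then have "isometry (\<lambda>z. s * \<omega> / cnj s * cnj (f z))"
      by (intro isometry_comp[OF isometry_mult isometry_comp[OF isometry_cnj f(1)]])
    moreover have "s * \<omega> / cnj s * cnj (f (s * lattice_point p)) = s * lattice_point (prod.swap (g p))" for p
      using assms(2) by (simp add: f(2)[THEN spec] lattice_point_swap)
    ultimately show ?case
      by blast
  qed
  then show ?thesis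
    using that by blast
qed

lemma tri_symmetry:
  assumes g: "lattice_symmetry g" and H: "\<And>p. g p \<in> honeycomb \<longleftrightarrow> p \<in> honeycomb"
  obtains f where "isometry f" "\<And>p. f ` tri_cell p = tri_cell (g p)"
proof -
  have "tri_scale \<noteq> 0"
    by (simp add: tri_scale_def omega_eq complex_eq_iff)
  obtain f where f: "isometry f" "\<And>p. f (tri_scale * lattice_point p) = tri_scale * lattice_point (g p)"
    using realise_symmetry[OF g \<open>tri_scale \<noteq> 0\<close>] by blast
  have corners: "g ` corners p = corners (g p)" for p
  proof (rule set_eqI)
    fix r
    obtain q where r: "r = g q"
      using bij_is_surj[OF bij_symmetry[OF g]] by (rule surjE)
    have "g q \<in> g ` corners p \<longleftrightarrow> q \<in> corners p"
      by (rule inj_image_mem_iff[OF inj_symmetry[OF g]])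
    also have "\<dots> \<longleftrightarrow> g q \<in> corners (g p)"
      by (simp add: corners_def adj_symmetry[OF g] H)
    finally show "r \<in> g ` corners p \<longleftrightarrow> r \<in> corners (g p)"
      by (simp only: r)
  qed
  have "f ` tri_cell p = tri_cell (g p)" for p
  proof -
    have "f ` tri_cell p = convex hull ((\<lambda>q. tri_scale * lattice_point q) ` (g ` corners p))"
      unfolding tri_cell_def isometry_convex_hull[OF f(1)] by (simp only: image_image f(2))
    then show ?thesis
      by (simp only: corners tri_cell_def)
  qed
  with f(1) show ?thesis
    by (rule that)
qed

text \<open>
  The vertices of a hexagon are not centres of hexagons, so the image of the cell is computed for each
  generator: the generator moves the centre and permutes the six vectors from the centre to the
  vertices by some map h. The factor \<open>\<omega>\<^sup>2\<close> for the swap comes from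
  \<open>\<omega>\<close> cnj (1 + \<open>\<omega>\<close>) = 1 + \<open>\<omega>\<close>.
\<close>
lemma hex_symmetry:
  assumes "lattice_symmetry g"
  obtains f where "isometry f" "\<And>p. f ` hex_cell p = hex_cell (g p)"
proof -
  let ?s = "1 + \<omega>"
  have vertices: "f ` hexagon c = hexagon c'"
    if "isometry f" "h ` unit_steps = unit_steps" "\<And>d. f (c + lattice_point d) = c' + lattice_point (h d)" for f c c' h
  proof -
    have "f ` hexagon c = convex hull ((\<lambda>d. c' + lattice_point d) ` (h ` unit_steps))"
      unfolding hexagon_eq isometry_convex_hull[OF that(1)] image_image that(3) ..
    then show ?thesis
      by (simp only: that(2) hexagon_eq)
  qed
  have steps: "(\<lambda>d. d) ` unit_steps = unit_steps" "rot ` unit_steps = unit_steps"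
    "(\<lambda>d. rot (prod.swap d)) ` unit_steps = unit_steps"
    by (simp_all add: unit_steps_def insert_commute)
  have "\<exists>f. isometry f \<and> (\<forall>p. f ` hex_cell p = hex_cell (g p))"
    using assms
  proof induction
    case id
    show ?case
      by (intro exI[of _ "\<lambda>z. z"]) (simp add: isometry_def)
  next
    case (shift g t)
    then obtain f where f: "isometry f" "\<And>p. f ` hex_cell p = hex_cell (g p)"
      by blast
    have "(\<lambda>z. z + ?s * lattice_point t) ` hex_cell p = hex_cell (p + t)" for p
      unfolding hex_cell_def
      by (rule vertices[OF isometry_add steps(1)]) (simp add: lattice_point_add algebra_simps)
    moreover have "(\<lambda>z. f z + ?s * lattice_point t) ` S = (\<lambda>z. z + ?s * lattice_point t) ` (f ` S)" for S
      by (simp only: image_image)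
    ultimately have "(\<lambda>z. f z + ?s * lattice_point t) ` hex_cell p = hex_cell (g p + t)" for p
      by (simp only: f(2))
    then show ?case
      using isometry_comp[OF isometry_add f(1)] by blast
  next
    case (rot g)
    then obtain f where f: "isometry f" "\<And>p. f ` hex_cell p = hex_cell (g p)"
      by blast
    have "(\<lambda>z. \<omega> * z) ` hex_cell p = hex_cell (rot p)" for p
      unfolding hex_cell_def
      by (rule vertices[OF isometry_mult[OF norm_omega] steps(2)]) (simp add: lattice_point_rot algebra_simps)
    moreover have "(\<lambda>z. \<omega> * f z) ` S = (\<lambda>z. \<omega> * z) ` (f ` S)" for S
      by (simp only: image_image)
    ultimately have "(\<lambda>z. \<omega> * f z) ` hex_cell p = hex_cell (rot (g p))" for p
      by (simp only: f(2))
    then show ?case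
      using isometry_comp[OF isometry_mult[OF norm_omega] f(1)] by blast
  next
    case (swap g)
    then obtain f where f: "isometry f" "\<And>p. f ` hex_cell p = hex_cell (g p)"
      by blast
    have refl: "isometry (\<lambda>z. \<omega> * \<omega> * cnj z)"
      by (intro isometry_comp[OF isometry_mult isometry_cnj]) (simp add: norm_mult norm_omega)
    have scale: "\<omega> * cnj ?s = ?s"
      by (simp add: cnj_omega algebra_simps omega_square)
    have "(\<lambda>z. \<omega> * \<omega> * cnj z) ` hex_cell p = hex_cell (prod.swap p)" for p
      unfolding hex_cell_def
    proof (rule vertices[OF refl steps(3)])
      fix d
      have "\<omega> * \<omega> * cnj (?s * lattice_point p + lattice_point d) =
          (\<omega> * cnj ?s) * (\<omega> * cnj (lattice_point p)) + \<omega> * (\<omega> * cnj (lattice_point d))"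
        by (simp add: algebra_simps)
      then show "\<omega> * \<omega> * cnj (?s * lattice_point p + lattice_point d) =
          ?s * lattice_point (prod.swap p) + lattice_point (rot (prod.swap d))"
        by (simp only: scale lattice_point_swap lattice_point_rot)
    qed
    moreover have "(\<lambda>z. \<omega> * \<omega> * cnj (f z)) ` S = (\<lambda>z. \<omega> * \<omega> * cnj z) ` (f ` S)" for S
      by (simp only: image_image)
    ultimately have "(\<lambda>z. \<omega> * \<omega> * cnj (f z)) ` hex_cell p = hex_cell (prod.swap (g p))" for p
      by (simp only: f(2))
    then show ?case
      using isometry_comp[OF refl f(1)] by blast
  qed
  then show ?thesis
    using that by blast
qed

section \<open>Counting the free saturated polyforms\<close>
lemma has_hub_image:
  assumes inj: "inj_on f V" and hom: "\<And>x y. x \<in> V \<Longrightarrow> y \<in> V \<Longrightarrow> E' (f x) (f y) \<longleftrightarrow> E x y"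
  shows "has_hub (f ` V) E' \<longleftrightarrow> has_hub V E"
proof -
  have val: "valency (f ` V) E' (f v) = valency V E v" if "v \<in> V" for v
    by (rule valency_image[OF inj that]) (rule hom)
  have "(\<forall>d\<in>f ` V. E' (f c) d \<longrightarrow> valency (f ` V) E' d \<noteq> 1) \<longleftrightarrow>
      (\<forall>d\<in>V. E c d \<longrightarrow> valency V E d \<noteq> 1)" if "c \<in> V" for c
    using that by (auto simp: val hom)
  then show ?thesis
    unfolding has_hub_def using val by auto
qed

lemma isometry_bij:
  assumes "isometry f"
  shows "bij f"
proof -
  obtain L where L: "linear L" "inj L" "\<And>x. f x = f 0 + L x"
    using isometry_affine[OF assms] by metis
  have "surj L"
    by (rule linear_inj_imp_surj[OF L(1,2)])
  then have "bij L"
    using L(2) by (simp add: bij_def)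
  moreover have "bij ((+) (f 0))"
    by (rule bij_plus)
  ultimately have "bij ((+) (f 0) \<circ> L)"
    by (rule bij_comp)
  moreover have "f = (+) (f 0) \<circ> L"
    unfolding comp_def by (rule ext) (rule L(3))
  ultimately show ?thesis
    by (simp only:)
qed

lemma tiling_isometry_iff: "tiling_isometry \<T> f \<longleftrightarrow> isometry f \<and> (\<lambda>C. f ` C) ` \<T> = \<T>"
  by (simp add: tiling_isometry_def isometry_def)

lemma congruence_iff:
  "(S, T) \<in> congruence \<T> \<longleftrightarrow>
     (\<exists>f. isometry f \<and> (\<lambda>C. f ` C) ` \<T> = \<T> \<and> T = (\<lambda>C. f ` C) ` S)"
  unfolding congruence_def by (simp add: tiling_isometry_iff conj_assoc)

lemma equiv_congruence: "equiv UNIV (congruence \<T>)"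
proof (rule equivI)
  show "congruence \<T> \<subseteq> UNIV \<times> UNIV"
    by simp
  show "refl (congruence \<T>)"
  proof (rule refl_onI)
    show "(T, T) \<in> congruence \<T>" for T
      unfolding congruence_iff by (rule exI[of _ "\<lambda>z. z"]) (simp add: isometry_def)
  qed
  show "sym (congruence \<T>)"
  proof (rule symI)
    fix S T
    assume "(S, T) \<in> congruence \<T>"
    then obtain f where f: "isometry f" "(\<lambda>C. f ` C) ` \<T> = \<T>" "T = (\<lambda>C. f ` C) ` S"
      unfolding congruence_iff by (elim exE conjE)
    have bij: "bij f"
      by (rule isometry_bij[OF f(1)])
    have cancel: "(\<lambda>C. inv f ` C) ` (\<lambda>C. f ` C) ` \<A> = \<A>" for \<A>
      by (simp add: image_image bij_is_inj[OF bij])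
    have "dist (inv f x) (inv f y) = dist (f (inv f x)) (f (inv f y))" for x y
      using f(1) by (simp add: isometry_def)
    then have "isometry (inv f)"
      by (simp add: isometry_def surj_f_inv_f[OF bij_is_surj[OF bij]])
    moreover have "(\<lambda>C. inv f ` C) ` \<T> = \<T>"
      using cancel[of \<T>] by (simp only: f(2))
    moreover have "S = (\<lambda>C. inv f ` C) ` T"
      unfolding f(3) cancel ..
    ultimately show "(T, S) \<in> congruence \<T>"
      unfolding congruence_iff by (intro exI[of _ "inv f"] conjI)
  qed
  show "trans (congruence \<T>)"
  proof (rule transI)
    fix R S T
    assume RS: "(R, S) \<in> congruence \<T>" and ST: "(S, T) \<in> congruence \<T>"
    obtain f where f: "isometry f" "(\<lambda>C. f ` C) ` \<T> = \<T>" "S = (\<lambda>C. f ` C) ` R"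
      using RS unfolding congruence_iff by (elim exE conjE)
    obtain g where g: "isometry g" "(\<lambda>C. g ` C) ` \<T> = \<T>" "T = (\<lambda>C. g ` C) ` S"
      using ST unfolding congruence_iff by (elim exE conjE)
    have comp: "(\<lambda>C. (\<lambda>z. g (f z)) ` C) ` \<A> = (\<lambda>C. g ` C) ` (\<lambda>C. f ` C) ` \<A>" for \<A>
      by (simp add: image_image)
    show "(R, T) \<in> congruence \<T>"
      unfolding congruence_iff
    proof (intro exI[of _ "\<lambda>z. g (f z)"] conjI)
      show "isometry (\<lambda>z. g (f z))"
        by (rule isometry_comp[OF g(1) f(1)])
      show "(\<lambda>C. (\<lambda>z. g (f z)) ` C) ` \<T> = \<T>"
        by (simp only: comp f(2) g(2))
      show "T = (\<lambda>C. (\<lambda>z. g (f z)) ` C) ` R"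
        by (simp only: comp f(3)[symmetric] g(3)[symmetric])
    qed
  qed
qed

lemma card_quotient_one:
  assumes r: "equiv UNIV r" and "a \<in> A" "\<And>x. x \<in> A \<Longrightarrow> (x, a) \<in> r"
  shows "card (A // r) = 1"
proof -
  have "r `` {x} = r `` {a}" if "x \<in> A" for x
    using equiv_class_eq[OF r assms(3)[OF that]] .
  then have "A // r = {r `` {a}}"
    using assms(2) unfolding quotient_def by blast
  then show ?thesis
    by simp
qed

lemma card_quotient_two:
  assumes r: "equiv UNIV r" and "a \<in> A" "b \<in> A" "(a, b) \<notin> r"
    and "\<And>x. x \<in> A \<Longrightarrow> (x, a) \<in> r \<or> (x, b) \<in> r"
  shows "card (A // r) = 2"
proof -
  have "r `` {x} = r `` {a} \<or> r `` {x} = r `` {b}" if "x \<in> A" for x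
    using equiv_class_eq[OF r] assms(5)[OF that] by blast
  then have "A // r = {r `` {a}, r `` {b}}"
    using assms(2,3) unfolding quotient_def by blast
  moreover have "r `` {a} \<noteq> r `` {b}"
    using assms(4) eq_equiv_class[OF _ r] by blast
  ultimately show ?thesis
    by simp
qed

text \<open>
  What the count requires of a tiling whose cells are indexed by a set X of lattice points. A symmetry
  of the lattice need not preserve X, but it does so, and is induced by an isometry of the plane, as
  soon as it maps one adjacent pair in X into X.
\<close>
locale tiling_model =
  fixes \<T> :: "complex set set" and X :: "(int \<times> int) set" and cell :: "int \<times> int \<Rightarrow> complex set"
  assumes cells: "\<T> = cell ` X"
    and inj: "inj_on cell X"
    and adjacent_iff: "p \<in> X \<Longrightarrow> q \<in> X \<Longrightarrow> adjacent (cell p) (cell q) \<longleftrightarrow> adj p q"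
    and zigzag_subset: "zigzag k \<subseteq> X"
    and tripod_subset: "tripod \<subseteq> X"
    and symmetry: "lattice_symmetry g \<Longrightarrow> adj p q \<Longrightarrow> {p, q, g p, g q} \<subseteq> X \<Longrightarrow>
      g ` X = X \<and> (\<exists>f. isometry f \<and> (\<forall>r\<in>X. f ` cell r = cell (g r)))"
begin

lemma tree_like_iff:
  assumes S: "S \<subseteq> X"
  shows "tree_like \<T> (cell ` S) \<longleftrightarrow> finite S \<and> graph_tree S adj"
proof -
  have injS: "inj_on cell S"
    using inj S by (rule inj_on_subset)
  have hom: "adjacent (cell p) (cell q) \<longleftrightarrow> adj p q" if "p \<in> S" "q \<in> S" for p q
    using that[THEN subsetD[OF S]] by (rule adjacent_iff)
  have sub: "cell ` S \<subseteq> \<T>"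
    unfolding cells using S by (rule image_mono)
  have fin: "finite (cell ` S) \<longleftrightarrow> finite S"
    by (rule finite_image_iff[OF injS])
  have forth: "graph_tree (cell ` S) adjacent" if "graph_tree S adj"
    by (rule graph_tree_image[OF that injS]) (rule hom)
  have converse: "graph_tree S adj" if tree: "graph_tree (cell ` S) adjacent"
  proof -
    let ?i = "the_inv_into S cell"
    have i: "?i (cell p) = p" if "p \<in> S" for p
      using that by (rule the_inv_into_f_f[OF injS])
    have "graph_tree (?i ` cell ` S) adj"
    proof (rule graph_tree_image[OF tree])
      show "inj_on ?i (cell ` S)"
        by (rule inj_on_the_inv_into[OF injS])
      fix C D
      assume "C \<in> cell ` S" "D \<in> cell ` S"
      then obtain p q where "C = cell p" "D = cell q" "p \<in> S" "q \<in> S"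
        by blast
      then show "adj (?i C) (?i D) \<longleftrightarrow> adjacent C D"
        by (simp only: i hom)
    qed
    moreover have "?i ` cell ` S = S"
      by (simp add: image_image i)
    ultimately show ?thesis
      by (simp only:)
  qed
  have "graph_tree (cell ` S) adjacent \<longleftrightarrow> graph_tree S adj"
    using converse forth by (rule iffI)
  then show ?thesis
    unfolding tree_like_def by (simp only: sub fin simp_thms)
qed

lemma num_leaves_cells:
  assumes S: "S \<subseteq> X"
  shows "num_leaves (cell ` S) = card {v \<in> S. valency S adj v = 1}"
proof -
  have injS: "inj_on cell S"
    using inj S by (rule inj_on_subset)
  have hom: "adjacent (cell p) (cell q) \<longleftrightarrow> adj p q" if "p \<in> S" "q \<in> S" for p q
    by (rule adjacent_iff) (use that S in blast)+
  have deg: "cell_degree (cell ` S) (cell v) = valency S adj v" if "v \<in> S" for v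
  proof -
    have "cell_degree (cell ` S) (cell v) = valency (cell ` S) adjacent (cell v)"
      by (simp add: cell_degree_def valency_def)
    also have "\<dots> = valency S adj v"
      by (rule valency_image[OF injS that]) (rule hom)
    finally show ?thesis .
  qed
  have "{C \<in> cell ` S. cell_degree (cell ` S) C = 1} = cell ` {v \<in> S. valency S adj v = 1}"
    using deg by auto
  moreover have "inj_on cell {v \<in> S. valency S adj v = 1}"
    using injS by (rule inj_on_subset) blast
  ultimately show ?thesis
    unfolding num_leaves_def by (simp add: card_image)
qed

lemma polyform_cells:
  assumes "T \<subseteq> \<T>"
  obtains S where "S \<subseteq> X" "T = cell ` S" "card T = card S"
proof
  let ?S = "{p \<in> X. cell p \<in> T}"
  show "?S \<subseteq> X"
    by blast
  show T: "T = cell ` ?S"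
    using assms by (auto simp: cells)
  show "card T = card ?S"
    using card_image[OF inj_on_subset[OF inj \<open>?S \<subseteq> X\<close>]] by (simp only: T[symmetric])
qed

lemma num_leaves_le:
  assumes "tree_like \<T> T"
  shows "2 * num_leaves T \<le> card T + 2"
proof -
  obtain S where S: "S \<subseteq> X" "T = cell ` S" "card T = card S"
    using polyform_cells assms unfolding tree_like_def by metis
  then have "finite S" "graph_tree S adj"
    using assms tree_like_iff by blast+
  then show ?thesis
    unfolding S(3) unfolding S(2) num_leaves_cells[OF S(1)]
    by (intro lattice.subcubic_tree_leaves(1) lattice_tree_valency_le)
qed

text \<open>
  A cubic tree on 2 k cells attains the upper bound k + 1 on the number of leaves, so it also shows
  that the maximum in the definition of fully leafed polyforms equals k + 1.
\<close>
lemma saturated_cells: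
  assumes S: "S \<subseteq> X" and card: "card S = 2 * k" and k: "k \<ge> 1"
  shows "saturated \<T> (cell ` S) \<longleftrightarrow> lattice.cubic_tree S"
proof -
  let ?T = "cell ` S"
  have cardT: "card ?T = 2 * k"
    using card card_image[OF inj_on_subset[OF inj S]] by simp
  have many: "real (num_leaves ?T) \<ge> leaf_bound (card ?T) \<longleftrightarrow> 2 * num_leaves ?T \<ge> card S + 2"
    unfolding leaf_bound_def cardT card by auto
  show ?thesis
  proof
    assume sat: "saturated \<T> ?T"
    then have "tree_like \<T> ?T" "2 * num_leaves ?T \<ge> card S + 2"
      using many by (simp_all add: saturated_def fully_leafed_def)
    then have tree: "finite S" "graph_tree S adj" and "2 * num_leaves ?T = card S + 2"
      using tree_like_iff[OF S] num_leaves_le[of ?T] by (simp_all add: card cardT)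
    then have "2 * card {v \<in> S. valency S adj v = 1} = card S + 2"
      by (simp only: num_leaves_cells[OF S])
    then have "\<forall>v\<in>S. valency S adj v = 1 \<or> valency S adj v = 3"
      using lattice.subcubic_tree_leaves(2)[OF tree] lattice_tree_valency_le[OF tree(2)] by blast
    then show "lattice.cubic_tree S"
      using tree by (simp add: lattice.cubic_tree_def)
  next
    assume "lattice.cubic_tree S"
    then have tree: "finite S" "graph_tree S adj" and deg: "\<forall>v\<in>S. valency S adj v = 1 \<or> valency S adj v = 3"
      by (simp_all add: lattice.cubic_tree_def)
    have "2 * card {v \<in> S. valency S adj v = 1} = card S + 2"
      using lattice.subcubic_tree_leaves(2)[OF tree] lattice_tree_valency_le[OF tree(2)] deg by blast
    then have leaves: "num_leaves ?T = k + 1"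
      by (simp add: num_leaves_cells[OF S] card)
    have "tree_like \<T> ?T"
      using tree_like_iff[OF S] tree by blast
    let ?M = "{num_leaves T | T. tree_like \<T> T \<and> card T = 2 * k}"
    have le: "m \<le> k + 1" if m: "m \<in> ?M" for m
    proof -
      obtain T where "m = num_leaves T" "tree_like \<T> T" "card T = 2 * k"
        using m by blast
      then show ?thesis
        using num_leaves_le[of T] by simp
    qed
    have "max_leaves \<T> (2 * k) = k + 1"
      unfolding max_leaves_def
    proof (rule Max_eqI)
      show "finite ?M"
        by (rule finite_subset[of _ "{..k + 1}"]) (use le in auto)
      show "k + 1 \<in> ?M"
        using \<open>tree_like \<T> ?T\<close> leaves cardT by force
    qed (rule le)
    then show "saturated \<T> ?T"
      using \<open>tree_like \<T> ?T\<close> leaves k many by (simp add: saturated_def fully_leafed_def cardT card)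
  qed
qed

text \<open>
  The pair p, q ensures that the symmetry taking S to S' preserves X: its image lies in S', hence in X.
\<close>
lemma equivalent_congruent:
  assumes S: "S \<subseteq> X" "S' \<subseteq> X" and "equivalent S S'" and "adj p q" "p \<in> S" "q \<in> S"
  shows "(cell ` S, cell ` S') \<in> congruence \<T>"
proof -
  obtain g where g: "lattice_symmetry g" "g ` S = S'"
    using assms(3) unfolding equivalent_def by blast
  have "{p, q, g p, g q} \<subseteq> X"
    using assms g(2) by blast
  then obtain f where X: "g ` X = X" and f: "isometry f" "\<And>r. r \<in> X \<Longrightarrow> f ` cell r = cell (g r)"
    using symmetry[OF g(1) assms(4)] by blast
  have image: "(\<lambda>C. f ` C) ` cell ` A = cell ` g ` A" if "A \<subseteq> X" for A
    unfolding image_image by (rule image_cong[OF refl f(2)]) (use that in blast)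
  have "(\<lambda>C. f ` C) ` \<T> = \<T>"
    by (simp only: cells image[OF subset_refl] X)
  moreover have "cell ` S' = (\<lambda>C. f ` C) ` cell ` S"
    by (simp only: image[OF S(1)] g(2))
  ultimately show ?thesis
    unfolding congruence_iff using f(1) by (intro exI[of _ f] conjI)
qed

lemma saturated_classification:
  assumes k: "k \<ge> 1" and T: "saturated \<T> T" "card T = 2 * k"
  shows "(T, cell ` zigzag k) \<in> congruence \<T> \<or> k = 5 \<and> (T, cell ` tripod) \<in> congruence \<T>"
proof -
  have tree_like: "tree_like \<T> T"
    using T(1) by (simp add: saturated_def fully_leafed_def)
  then obtain S where S: "S \<subseteq> X" "T = cell ` S" "card T = card S"
    using polyform_cells unfolding tree_like_def by metis
  have card: "card S = 2 * k"
    using S(3) T(2) by simp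
  have cubic: "lattice.cubic_tree S"
    using saturated_cells[OF S(1) card k] T(1) by (simp only: S(2))
  have conn: "graph_connected S adj" and "S \<noteq> {}"
    using cubic by (auto simp: lattice.cubic_tree_def graph_tree_def graph_connected_def)
  then obtain p where p: "p \<in> S"
    by blast
  obtain q where q: "q \<in> S" "adj p q"
    by (rule lattice.connected_neighbour[OF conn p]) (use card k in simp)
  show ?thesis
    using cubic_tree_classification[OF k cubic card]
      equivalent_congruent[OF S(1) zigzag_subset _ q(2) p q(1)]
      equivalent_congruent[OF S(1) tripod_subset _ q(2) p q(1)]
    unfolding S(2) by blast
qed

lemma zigzag_tripod_not_congruent:
  assumes "k \<ge> 1"
  shows "(cell ` zigzag k, cell ` tripod) \<notin> congruence \<T>"
proof
  assume "(cell ` zigzag k, cell ` tripod) \<in> congruence \<T>"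
  then obtain f where f: "isometry f" "cell ` tripod = (\<lambda>C. f ` C) ` cell ` zigzag k"
    unfolding congruence_iff by (elim exE conjE)
  have cells_hub: "has_hub (cell ` S) adjacent \<longleftrightarrow> has_hub S adj" if "S \<subseteq> X" for S
    by (rule has_hub_image[OF inj_on_subset[OF inj that]]) (use adjacent_iff that in blast)
  have "inj_on (\<lambda>C. f ` C) A" for A
    using bij_is_inj[OF isometry_bij[OF f(1)]] by (simp add: inj_on_def inj_image_eq_iff)
  then have "has_hub ((\<lambda>C. f ` C) ` cell ` zigzag k) adjacent \<longleftrightarrow> has_hub (cell ` zigzag k) adjacent"
    by (rule has_hub_image) (rule isometry_adjacent[OF f(1)])
  then have "has_hub tripod adj \<longleftrightarrow> has_hub (zigzag k) adj"
    by (simp only: f(2)[symmetric] cells_hub[OF zigzag_subset] cells_hub[OF tripod_subset])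
  then show False
    using tripod_has_hub zigzag_no_hub[OF assms] by blast
qed

theorem card_free_saturated:
  assumes k: "k \<ge> 1"
  shows "card (free_saturated \<T> (2 * k)) = (if k = 5 then 2 else 1)"
proof -
  let ?A = "{T. saturated \<T> T \<and> card T = 2 * k}"
  have zigzag: "cell ` zigzag k \<in> ?A"
    using zigzag_cubic_tree[OF k] saturated_cells[OF zigzag_subset _ k]
      card_image[OF inj_on_subset[OF inj zigzag_subset]] by simp
  show ?thesis
  proof (cases "k = 5")
    case True
    have "card tripod = 2 * k"
      using tripod_cubic_tree(2) True by simp
    then have "cell ` tripod \<in> ?A"
      using tripod_cubic_tree(1) saturated_cells[OF tripod_subset _ k]
        card_image[OF inj_on_subset[OF inj tripod_subset]] by simp
    then have "card (?A // congruence \<T>) = 2"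
      using zigzag zigzag_tripod_not_congruent[OF k] saturated_classification[OF k]
      by (intro card_quotient_two[OF equiv_congruence, of "cell ` zigzag k" _ "cell ` tripod"]) auto
    then show ?thesis
      using True by (simp add: free_saturated_def)
  next
    case False
    have "card (?A // congruence \<T>) = 1"
      using zigzag saturated_classification[OF k] False
      by (intro card_quotient_one[OF equiv_congruence, of "cell ` zigzag k"]) auto
    then show ?thesis
      using False by (simp add: free_saturated_def)
  qed
qed

end

interpretation hex: tiling_model hex_tiling UNIV hex_cell
proof
  show "inj_on hex_cell UNIV"
    by (simp add: inj_on_def hex_cell_eq_iff)
  fix g p q
  assume g: "lattice_symmetry g"
  obtain f where "isometry f" "\<And>p. f ` hex_cell p = hex_cell (g p)"
    using hex_symmetry[OF g] by blast
  then show "g ` UNIV = UNIV \<and> (\<exists>f. isometry f \<and> (\<forall>r\<in>UNIV. f ` hex_cell r = hex_cell (g r)))"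
    using bij_is_surj[OF bij_symmetry[OF g]] by blast
qed (simp_all add: hex_tiling_eq hex_cell_adjacent)

interpretation tri: tiling_model tri_tiling honeycomb tri_cell
proof
  show "inj_on tri_cell honeycomb"
    by (simp add: inj_on_def tri_cell_eq_iff)
  fix g p q
  assume g: "lattice_symmetry g" and pq: "adj p q" "{p, q, g p, g q} \<subseteq> honeycomb"
  have H: "g r \<in> honeycomb \<longleftrightarrow> r \<in> honeycomb" for r
    by (rule symmetry_honeycomb[OF g pq])
  have "g ` honeycomb = honeycomb"
  proof (intro set_eqI iffI)
    fix r
    assume "r \<in> honeycomb"
    moreover obtain s where "r = g s"
      using bij_is_surj[OF bij_symmetry[OF g]] by (rule surjE)
    ultimately show "r \<in> g ` honeycomb"
      using H by blast
  qed (use H in blast)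
  moreover obtain f where "isometry f" "\<And>p. f ` tri_cell p = tri_cell (g p)"
    using tri_symmetry[OF g H] by blast
  ultimately show "g ` honeycomb = honeycomb \<and>
      (\<exists>f. isometry f \<and> (\<forall>r\<in>honeycomb. f ` tri_cell r = tri_cell (g r)))"
    by blast
qed (simp_all add: tri_tiling_eq tri_cell_adjacent zigzag_subset_honeycomb tripod_subset_honeycomb)

theorem corollary6p10:
  fixes k :: nat
  assumes "k \<ge> 1"
  shows "shex_i (2 * k) = stri_i (2 * k) \<and> stri_i (2 * k) = (if k = 5 then 2 else 1)"
  unfolding shex_i_def stri_i_def hex.card_free_saturated[OF assms] tri.card_free_saturated[OF assms]
  by simp

end
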